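(* Consider the independent block-fading binary symmetric wiretap channel with parameters $q_1,q_1^*\in[0,1]$, $q_2=1-q_1$, $q_2^*=1-q_1^*$, and crossover probabilities satisfying $p_1\le p_2\le p_1^*\le p_2^*\le 0.5$. Its secrecy capacity with channel state information available only at the decoders is $$C^s_{\textrm{CSI-D}}= q_1^*H(p_1^* )+q_2^*H(p_2^* )-q_1H(p_1)-q_2H(p_2).$$
   Context: $H(p)=-p\log_2 p-(1-p)\log_2(1-p)$ is the binary entropy function, and BSC$(p)$ denotes the binary symmetric channel with crossover probability $p$. Independent block-fading binary symmetric wiretap channel: the transmitter sends $NB$ binary symbols $X_{1:NB}$ organized in $B$ fading blocks of length $N$. Each block $k$ has a main-channel state $S_k\in\{1,2\}$ with $\Pr(S_k=1)=q_1$ and an eavesdropper-channel state $S^*_k\in\{1,2\}$ with $\Pr(S_k^*=1)=q_1^*$; all these states are mutually independent (across blocks and between the two channels) and constant within a block. Within block $k$, the legitimate receiver observes the output $Y$ of $N$ independent uses of BSC$(p_{S_k})$, and the eavesdropper observes the output $Z$ of $N$ independent uses of BSC$(p^*_{S^*_k})$. Let $\mathsf{S}$ denote all the state realizations $(S_k,S_k^* )_{k=1}^B$. A code consists of a (possibly randomized) encoder $X_{1:NB}=f(\mathsf{M})$ of a uniformly distributed message $\mathsf{M}$, which knows only the state distributions (not the realizations), and a decoder $\hat{\mathsf{M}}=g(Y_{1:NB},\mathsf{S})$; its rate is $\frac{1}{NB}\log_2$ of the message-set size. A rate $R$ is achievable if there are such codes of rate at least $R$ (asymptotically) with $N,B\to\infty$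 such that $\Pr\{\mathsf{M}\ne\hat{\mathsf{M}}\}\to0$ and $\frac{1}{NB}I(\mathsf{M};Z_{1:NB}\mid\mathsf{S})\to 0$. $C^s_{\textrm{CSI-D}}$ is the supremum of achievable rates. *)

theory Defs
  imports "HOL-Probability.Probability"
begin

definition bin_entropy :: "real \<Rightarrow> real" where
  "bin_entropy p = - p * log 2 p - (1 - p) * log 2 (1 - p)"

primrec bern_list :: "real list \<Rightarrow> bool list pmf" where
  "bern_list [] = return_pmf []"
| "bern_list (p # ps) = bind_pmf (bernoulli_pmf p) (\<lambda>b. map_pmf (\<lambda>bs. b # bs) (bern_list ps))"

text \<open>Block states are encoded as booleans: True means state 1, False means state 2.
  Crossover probability of a symbol at position i, given block states s and block length N.\<close>
definition xover :: "real \<Rightarrow> real \<Rightarrow> nat \<Rightarrow> bool list \<Rightarrow> nat \<Rightarrow> real" where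
  "xover pa pb N s i = (if s ! (i div N) then pa else pb)"

definition bf_noise :: "real \<Rightarrow> real \<Rightarrow> nat \<Rightarrow> nat \<Rightarrow> bool list \<Rightarrow> bool list pmf" where
  "bf_noise pa pb N B s = bern_list (map (xover pa pb N s) [0..<N*B])"

definition wt_joint ::
  "real \<Rightarrow> real \<Rightarrow> real \<Rightarrow> real \<Rightarrow> real \<Rightarrow> real \<Rightarrow> nat \<Rightarrow> nat \<Rightarrow> nat \<Rightarrow> (nat \<Rightarrow> bool list pmf)
    \<Rightarrow> (nat \<times> (bool list \<times> bool list) \<times> bool list \<times> bool list \<times> bool list) pmf" where
  "wt_joint q1 q1s p1 p2 p1s p2s N B Msz f =
     do { m \<leftarrow> pmf_of_set {..<Msz};
          s \<leftarrow> bern_list (replicate B q1);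
          ss \<leftarrow> bern_list (replicate B q1s);
          x \<leftarrow> f m;
          ey \<leftarrow> bf_noise p1 p2 N B s;
          ez \<leftarrow> bf_noise p1s p2s N B ss;
          return_pmf (m, (s, ss), x, map2 (\<noteq>) x ey, map2 (\<noteq>) x ez) }"

definition cond_mi :: "('a \<times> 'b \<times> 'c) pmf \<Rightarrow> real" where
  "cond_mi J = (\<Sum>t\<in>set_pmf J. case t of (a, b, c) \<Rightarrow>
      pmf J (a, b, c) * log 2 ((pmf J (a, b, c) * pmf (map_pmf (\<lambda>(a, b, c). c) J) c) /
        (pmf (map_pmf (\<lambda>(a, b, c). (a, c)) J) (a, c) * pmf (map_pmf (\<lambda>(a, b, c). (b, c)) J) (b, c))))"

definition wt_err ::
  "real \<Rightarrow> real \<Rightarrow> real \<Rightarrow> real \<Rightarrow> real \<Rightarrow> real \<Rightarrow> nat \<Rightarrow> nat \<Rightarrow> nat \<Rightarrow> (nat \<Rightarrow> bool list pmf)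
    \<Rightarrow> (bool list \<Rightarrow> bool list \<times> bool list \<Rightarrow> nat) \<Rightarrow> real" where
  "wt_err q1 q1s p1 p2 p1s p2s N B Msz f g =
     measure_pmf.prob (wt_joint q1 q1s p1 p2 p1s p2s N B Msz f)
       {(m, st, x, y, z). g y st \<noteq> m}"

definition wt_leak ::
  "real \<Rightarrow> real \<Rightarrow> real \<Rightarrow> real \<Rightarrow> real \<Rightarrow> real \<Rightarrow> nat \<Rightarrow> nat \<Rightarrow> nat \<Rightarrow> (nat \<Rightarrow> bool list pmf) \<Rightarrow> real" where
  "wt_leak q1 q1s p1 p2 p1s p2s N B Msz f =
     cond_mi (map_pmf (\<lambda>(m, st, x, y, z). (m, z, st)) (wt_joint q1 q1s p1 p2 p1s p2s N B Msz f))"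

definition achievable_csid ::
  "real \<Rightarrow> real \<Rightarrow> real \<Rightarrow> real \<Rightarrow> real \<Rightarrow> real \<Rightarrow> real \<Rightarrow> bool" where
  "achievable_csid q1 q1s p1 p2 p1s p2s R \<longleftrightarrow>
     (\<exists>(N :: nat \<Rightarrow> nat) (B :: nat \<Rightarrow> nat) (Msz :: nat \<Rightarrow> nat)
        (f :: nat \<Rightarrow> nat \<Rightarrow> bool list pmf) (g :: nat \<Rightarrow> bool list \<Rightarrow> bool list \<times> bool list \<Rightarrow> nat).
        (\<forall>n. Msz n \<ge> 1) \<and>
        (\<forall>n m x. m < Msz n \<longrightarrow> x \<in> set_pmf (f n m) \<longrightarrow> length x = N n * B n) \<and>
        filterlim N at_top sequentially \<and> filterlim B at_top sequentially \<and>
        (\<forall>\<epsilon>>0. eventually (\<lambda>n. log 2 (real (Msz n)) / real (N n * B n) \<ge> R - \<epsilon>) sequentially) \<and>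
        ((\<lambda>n. wt_err q1 q1s p1 p2 p1s p2s (N n) (B n) (Msz n) (f n) (g n)) \<longlonglongrightarrow> 0) \<and>
        ((\<lambda>n. wt_leak q1 q1s p1 p2 p1s p2s (N n) (B n) (Msz n) (f n) / real (N n * B n)) \<longlonglongrightarrow> 0))"

definition secrecy_capacity_csid :: "real \<Rightarrow> real \<Rightarrow> real \<Rightarrow> real \<Rightarrow> real \<Rightarrow> real \<Rightarrow> real" where
  "secrecy_capacity_csid q1 q1s p1 p2 p1s p2s = Sup {R. achievable_csid q1 q1s p1 p2 p1s p2s R}"

end

theory Submission
  imports Defs
begin

text \<open>Converse: for fixed channel states the eavesdropper's noise is the receiver's noise with some
  independent noise added. Hence the output entropy is larger at the eavesdropper, while adding
  noise to a given message's codeword distribution raises the entropy by at most what it raises the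
  entropy of the noise itself (data processing); so the two mutual informations with the message
  differ by at most the difference of the two noise entropies, and Fano's inequality concludes.

  Achievability: random codebooks with \<open>K\<close> uniformly chosen codewords per message, with \<open>K\<close> just
  above \<open>2 ^ (n (1 - hz))\<close>, where \<open>hz\<close> is the mean noise entropy rate of the eavesdropper. Pairwise
  independence of the codewords gives the union bound for threshold decoding, and, by concavity of
  the logarithm, a bound on the divergence of the eavesdropper's output from the uniform
  distribution. Both bounds are controlled by Chebyshev's inequality for the log-probability of
  the noise, whose variance comes partly from the noise and partly from the block states.\<close>

section \<open>Bit strings\<close>

text \<open>The encoder does not know the states, so one code must serve all their realizations. The
  converse can still treat each realization separately: \<open>p2 \<le> p1s\<close> puts the
  receiver's worst state at or below the eavesdropper's best in noise, so degradation holds for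
  every pair of realizations, and the resulting bounds are linear enough to be averaged. No
  reduction to single letters is made: degradation is applied to whole strings, and only the entropy
  of the noise, whose bits are independent, is split into a sum. The model draws the two noises
  independently given the states, but error and leakage each see one marginal, so degradation in law
  is enough. In achievability the threshold and \<open>K\<close> are fixed from mean entropy rates.
  For given states the true rates deviate from these means, which contributes a variance of order
  \<open>n^2 / B\<close> that longer blocks do not reduce relative to \<open>n^2\<close>. Hence
  every bound ends as a constant over \<open>B\<close>. Error and leakage rate are averaged as a
  single sum over states and codebooks, so one codebook makes both small.\<close>

definition bits :: "nat \<Rightarrow> bool list set" where
  "bits n = {xs. length xs = n}"

definition bxor :: "bool list \<Rightarrow> bool list \<Rightarrow> bool list" where
  "bxor x y = map2 (\<noteq>) x y"

lemma in_bits_iff [simp]: "xs \<in> bits n \<longleftrightarrow> length xs = n"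
  by (simp add: bits_def)

lemma bits_0: "bits 0 = {[]}"
  by (auto simp: bits_def)

lemma bits_Suc: "bits (Suc n) = (\<lambda>(b, bs). b # bs) ` (UNIV \<times> bits n)"
  by (auto simp: bits_def length_Suc_conv image_iff)

lemma finite_bits [simp]: "finite (bits n)"
  by (induction n) (simp_all add: bits_0 bits_Suc)

lemma sum_bits_Suc:
  "(\<Sum>xs\<in>bits (Suc n). F xs) = (\<Sum>xs\<in>bits n. F (True # xs) + (F (False # xs) :: real))"
proof -
  have "(\<Sum>xs\<in>bits (Suc n). F xs) = (\<Sum>b\<in>UNIV. \<Sum>xs\<in>bits n. F (b # xs))"
    unfolding bits_Suc sum.cartesian_product
    by (subst sum.reindex) (auto simp: inj_on_def intro: sum.cong)
  then show ?thesis by (simp add: UNIV_bool sum.distrib)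
qed

lemma card_bits: "card (bits n) = 2 ^ n"
proof -
  have "real (card (bits n)) = 2 ^ n" for n
  proof (induction n)
    case (Suc n)
    have "real (card (bits (Suc n))) = (\<Sum>xs\<in>bits (Suc n). 1)" by simp
    also have "\<dots> = 2 * real (card (bits n))" by (subst sum_bits_Suc) simp
    finally show ?case using Suc by simp
  qed (simp add: bits_0)
  then show ?thesis by (metis of_nat_eq_iff of_nat_numeral of_nat_power)
qed

lemma length_bxor [simp]: "length (bxor x y) = min (length x) (length y)"
  by (simp add: bxor_def)

lemma bxor_Nil [simp]: "bxor [] y = []" "bxor x [] = []"
  by (simp_all add: bxor_def)

lemma bxor_Cons [simp]: "bxor (a # x) (b # y) = (a \<noteq> b) # bxor x y"
  by (simp add: bxor_def)

lemma bxor_commute: "bxor x y = bxor y x"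
  by (induction x y rule: list_induct2') auto

lemma bxor_assoc: "bxor (bxor x y) z = bxor x (bxor y z)"
proof (induction x y arbitrary: z rule: list_induct2')
  case (4 a x b y)
  then show ?case by (cases z) auto
qed auto

lemma bxor_cancel [simp]: "length x = length y \<Longrightarrow> bxor x (bxor x y) = y"
  by (induction x y rule: list_induct2) auto

text \<open>Translation by \<open>a\<close> is an involution of \<open>bits n\<close>. This
  invariance gives every codeword the same noise entropy and keeps a uniform codeword uniform after
  a shift.\<close>

lemma sum_bits_bxor:
  assumes "length a = n"
  shows "(\<Sum>z\<in>bits n. F (bxor a z)) = (\<Sum>z\<in>bits n. F z)"
  by (rule sum.reindex_bij_witness[of _ "bxor a" "bxor a"]) (use assms in auto)

lemma set_bern_list: "set_pmf (bern_list ps) \<subseteq> bits (length ps)"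
  by (induction ps) auto

lemma pmf_bern_list_Cons:
  assumes "0 \<le> p" "p \<le> 1"
  shows "pmf (bern_list (p # ps)) (b # bs) = (if b then p else 1 - p) * pmf (bern_list ps) bs"
proof -
  have *: "pmf (map_pmf ((#) c) (bern_list ps)) (b # bs) =
        (if c = b then pmf (bern_list ps) bs else 0)" for c
  proof (cases "c = b")
    case True
    then show ?thesis using pmf_map_inj'[of "\<lambda>bs. c # bs" "bern_list ps" bs] by (simp add: inj_def)
  next
    case False
    then show ?thesis by (auto simp: pmf_eq_0_set_pmf)
  qed
  show ?thesis using assms by (simp add: pmf_bind * mult.commute)
qed

section \<open>Divergence, entropy and mutual information\<close>

definition kl :: "'a set \<Rightarrow> ('a \<Rightarrow> real) \<Rightarrow> ('a \<Rightarrow> real) \<Rightarrow> real" where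
  "kl A p q = (\<Sum>x\<in>A. p x * log 2 (p x / q x))"

definition ent :: "'a set \<Rightarrow> ('a \<Rightarrow> real) \<Rightarrow> real" where
  "ent A p = - (\<Sum>x\<in>A. p x * log 2 (p x))"

text \<open>Termwise \<open>ln r \<le> r - 1\<close>, summed. Only total masses are compared, so
  that \<open>q\<close> can be a subprobability, as in \<open>fano_inequality\<close>, or a rescaled
  weight, as in \<open>log_sum_inequality\<close>. Positivity of \<open>q\<close> where
  \<open>p\<close> is positive excludes terms that should be infinite but evaluate to 0 in
  HOL.\<close>

lemma gibbs:
  assumes "\<And>x. x \<in> A \<Longrightarrow> 0 \<le> p x" "\<And>x. x \<in> A \<Longrightarrow> 0 \<le> q x"
    and "\<And>x. x \<in> A \<Longrightarrow> p x > 0 \<Longrightarrow> q x > 0" and "sum q A \<le> sum p A"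
  shows "0 \<le> kl A p q"
proof -
  have "(p x - q x) / ln 2 \<le> p x * log 2 (p x / q x)" if "x \<in> A" for x
  proof (cases "p x = 0")
    case True
    then show ?thesis using assms(2)[OF that] by (simp add: divide_nonpos_pos)
  next
    case False
    then have p: "p x > 0" and q: "q x > 0" using assms(1,3)[OF that] by auto
    have "ln (q x / p x) \<le> q x / p x - 1" using p q by (intro ln_le_minus_one) auto
    then have "p x * (1 - q x / p x) \<le> p x * ln (p x / q x)"
      using p q by (intro mult_left_mono) (auto simp: ln_div)
    moreover have "p x * (1 - q x / p x) = p x - q x" using p by (simp add: field_simps)
    ultimately show ?thesis by (simp add: log_def divide_right_mono)
  qed
  then have "(\<Sum>x\<in>A. (p x - q x) / ln 2) \<le> kl A p q"
    unfolding kl_def by (rule sum_mono)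
  moreover have "(\<Sum>x\<in>A. (p x - q x) / ln 2) = (sum p A - sum q A) / ln 2"
    by (simp add: sum_subtractf flip: sum_divide_distrib)
  ultimately show ?thesis using assms(4) by (smt (verit) divide_nonneg_pos ln_gt_zero)
qed

text \<open>Gibbs' inequality for \<open>a\<close> against \<open>b\<close> rescaled to the same
  total mass; the scale factor \<open>?r\<close> leaves the logarithm and becomes the left-hand
  side.\<close>

lemma log_sum_inequality:
  assumes "finite A" "\<And>x. x \<in> A \<Longrightarrow> 0 \<le> a x" "\<And>x. x \<in> A \<Longrightarrow> 0 \<le> b x"
    and "\<And>x. x \<in> A \<Longrightarrow> a x > 0 \<Longrightarrow> b x > 0"
  shows "sum a A * log 2 (sum a A / sum b A) \<le> (\<Sum>x\<in>A. a x * log 2 (a x / b x))"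
proof (cases "sum a A = 0")
  case True
  then have "\<forall>x\<in>A. a x = 0" using assms(1,2) sum_nonneg_eq_0_iff by blast
  then show ?thesis by simp
next
  case False
  let ?r = "sum a A / sum b A"
  have pa: "sum a A > 0" using False sum_nonneg[of A a] assms(2) by fastforce
  then obtain x where "x \<in> A" "a x > 0" by (meson not_less sum_nonpos)
  then have pb: "sum b A > 0" using assms by (meson sum_pos2)
  have r: "?r > 0" using pa pb by simp
  have "0 \<le> kl A a (\<lambda>x. b x * ?r)"
  proof (rule gibbs)
    have "(\<Sum>x\<in>A. b x * ?r) = sum a A" using pb unfolding sum_distrib_right[symmetric] by simp
    then show "(\<Sum>x\<in>A. b x * ?r) \<le> sum a A" by simp
  qed (use assms r in \<open>auto intro!: mult_nonneg_nonneg mult_pos_pos simp del: times_divide_eq_right\<close>)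
  also have "kl A a (\<lambda>x. b x * ?r) = (\<Sum>x\<in>A. a x * log 2 (a x / b x) - a x * log 2 ?r)"
    unfolding kl_def
  proof (rule sum.cong)
    fix x assume x: "x \<in> A"
    show "a x * log 2 (a x / (b x * ?r)) = a x * log 2 (a x / b x) - a x * log 2 ?r"
    proof (cases "a x = 0")
      case False
      then have "a x > 0" "b x > 0" using assms(2,4)[OF x] by force+
      then have "log 2 (a x / b x / ?r) = log 2 (a x / b x) - log 2 ?r"
        using r by (intro log_divide_pos) auto
      then show ?thesis by (simp add: right_diff_distrib mult.commute)
    qed simp
  qed simp
  finally show ?thesis by (simp add: sum_subtractf flip: sum_distrib_right)
qed

text \<open>For each \<open>v\<close>, the log-sum inequality over \<open>u\<close> yields terms in
  which \<open>d u v\<close> cancels inside the logarithm; the rows of \<open>d\<close> then sum to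
  1. The weights are unnormalised so that \<open>b\<close> can be the counting measure in
  \<open>ent_noisy_ge\<close>.\<close>

lemma kl_data_processing:
  assumes "finite U" "\<And>u. u \<in> U \<Longrightarrow> 0 \<le> a u" "\<And>u. u \<in> U \<Longrightarrow> 0 \<le> b u"
    and "\<And>u. u \<in> U \<Longrightarrow> a u > 0 \<Longrightarrow> b u > 0"
    and "\<And>u v. u \<in> U \<Longrightarrow> v \<in> V \<Longrightarrow> 0 \<le> d u v"
    and "\<And>u. u \<in> U \<Longrightarrow> (\<Sum>v\<in>V. d u v) = 1"
  shows "kl V (\<lambda>v. \<Sum>u\<in>U. a u * d u v) (\<lambda>v. \<Sum>u\<in>U. b u * d u v) \<le> kl U a b"
proof -
  have "kl V (\<lambda>v. \<Sum>u\<in>U. a u * d u v) (\<lambda>v. \<Sum>u\<in>U. b u * d u v) \<le>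
      (\<Sum>v\<in>V. \<Sum>u\<in>U. (a u * d u v) * log 2 ((a u * d u v) / (b u * d u v)))"
    unfolding kl_def
  proof (intro sum_mono log_sum_inequality)
    fix v u assume v: "v \<in> V" and u: "u \<in> U" and "0 < a u * d u v"
    then have "a u > 0" "d u v > 0" using assms(2,5) by (force simp: zero_less_mult_iff)+
    then show "0 < b u * d u v" using assms(4) u by simp
  qed (use assms in auto)
  also have "\<dots> = (\<Sum>v\<in>V. \<Sum>u\<in>U. d u v * (a u * log 2 (a u / b u)))"
    by (intro sum.cong) auto
  also have "\<dots> = (\<Sum>u\<in>U. (\<Sum>v\<in>V. d u v) * (a u * log 2 (a u / b u)))"
    by (subst sum.swap) (simp add: sum_distrib_right)
  also have "\<dots> = kl U a b" using assms(6) by (simp add: kl_def)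
  finally show ?thesis .
qed

lemma pmf_bind_finite:
  assumes "set_pmf p \<subseteq> A" "finite A"
  shows "pmf (bind_pmf p f) y = (\<Sum>x\<in>A. pmf p x * pmf (f x) y)"
  unfolding pmf_bind using assms by (subst integral_measure_pmf_real[of A]) (auto simp: mult.commute)

text \<open>Mutual information of input law \<open>P\<close> and channel \<open>K\<close>, as the
  mean divergence of the conditional output laws from the overall output law. \<open>S\<close> is
  meant to be a finite set containing all outputs.\<close>

definition mutual_inf :: "'b set \<Rightarrow> 'a pmf \<Rightarrow> ('a \<Rightarrow> 'b pmf) \<Rightarrow> real" where
  "mutual_inf S P K = (\<Sum>m\<in>set_pmf P. pmf P m * kl S (pmf (K m)) (pmf (bind_pmf P K)))"

lemma kl_eq_cross_entropy:
  assumes "\<And>x. x \<in> A \<Longrightarrow> 0 \<le> p x" "\<And>x. x \<in> A \<Longrightarrow> 0 \<le> q x" "\<And>x. x \<in> A \<Longrightarrow> p x > 0 \<Longrightarrow> q x > 0"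
  shows "kl A p q = - ent A p - (\<Sum>x\<in>A. p x * log 2 (q x))"
proof -
  have "kl A p q = (\<Sum>x\<in>A. p x * log 2 (p x) - p x * log 2 (q x))"
    unfolding kl_def
  proof (rule sum.cong)
    fix x assume x: "x \<in> A"
    show "p x * log 2 (p x / q x) = p x * log 2 (p x) - p x * log 2 (q x)"
    proof (cases "p x = 0")
      case False
      then have "p x > 0" "q x > 0" using assms(1,3)[OF x] by force+
      then show ?thesis by (simp add: log_divide_pos right_diff_distrib)
    qed simp
  qed simp
  then show ?thesis by (simp add: ent_def sum_subtractf)
qed

lemma pmf_bind_pos:
  assumes "m \<in> set_pmf P" "pmf (K m) z > 0"
  shows "pmf (bind_pmf P K) z > 0"
  using assms by (auto simp: pmf_positive_iff)

lemma mutual_inf_eq_ent: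
  assumes "finite (set_pmf P)"
  shows "mutual_inf S P K = ent S (pmf (bind_pmf P K)) - (\<Sum>m\<in>set_pmf P. pmf P m * ent S (pmf (K m)))"
proof -
  let ?Q = "bind_pmf P K"
  have "mutual_inf S P K =
      (\<Sum>m\<in>set_pmf P. pmf P m * (- ent S (pmf (K m)) - (\<Sum>x\<in>S. pmf (K m) x * log 2 (pmf ?Q x))))"
    unfolding mutual_inf_def
    by (intro sum.cong refl arg_cong2[where f="(*)"] kl_eq_cross_entropy) (auto intro: pmf_bind_pos)
  also have "\<dots> = - (\<Sum>m\<in>set_pmf P. pmf P m * ent S (pmf (K m)))
       - (\<Sum>m\<in>set_pmf P. \<Sum>x\<in>S. pmf P m * pmf (K m) x * log 2 (pmf ?Q x))"
    by (simp add: right_diff_distrib sum_subtractf sum_negf sum_distrib_left mult.assoc)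
  also have "(\<Sum>m\<in>set_pmf P. \<Sum>x\<in>S. pmf P m * pmf (K m) x * log 2 (pmf ?Q x)) = - ent S (pmf ?Q)"
    unfolding ent_def
    by (subst sum.swap) (simp add: pmf_bind_finite[OF order_refl assms] sum_distrib_right)
  finally show ?thesis by simp
qed

text \<open>Data processing for the divergence, one input at a time: by associativity of bind, the
  output law of the composite channel is \<open>D\<close> applied to the old output law.\<close>

lemma mutual_inf_data_processing:
  assumes P: "finite (set_pmf P)" and U: "finite U" and V: "finite V"
    and K: "\<And>m. m \<in> set_pmf P \<Longrightarrow> set_pmf (K m) \<subseteq> U"
    and D: "\<And>u. u \<in> U \<Longrightarrow> set_pmf (D u) \<subseteq> V"
  shows "mutual_inf V P (\<lambda>m. bind_pmf (K m) D) \<le> mutual_inf U P K"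
proof -
  have Q: "set_pmf (bind_pmf P K) \<subseteq> U" using K by auto
  show ?thesis unfolding mutual_inf_def
  proof (intro sum_mono mult_left_mono)
    fix m assume m: "m \<in> set_pmf P"
    have "kl V (pmf (bind_pmf (K m) D)) (pmf (bind_pmf (bind_pmf P K) D)) \<le> kl U (pmf (K m)) (pmf (bind_pmf P K))"
      unfolding pmf_bind_finite[OF Q U, of D] pmf_bind_finite[OF K[OF m] U, of D]
      using U V D m by (intro kl_data_processing) (auto intro: pmf_bind_pos simp: sum_pmf_eq_1)
    then show "kl V (pmf (bind_pmf (K m) D)) (pmf (bind_pmf P (\<lambda>m. bind_pmf (K m) D))) \<le>
         kl U (pmf (K m)) (pmf (bind_pmf P K))" by (simp add: bind_assoc_pmf)
  qed simp
qed

text \<open>This form is linear in the success probability, so \<open>converse_bound\<close> can use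
  it for each state realization and average afterwards.\<close>

lemma fano_inequality:
  fixes K :: "nat \<Rightarrow> 'b pmf"
  assumes M: "M \<ge> 1" and S: "finite S" and K: "\<And>m. m < M \<Longrightarrow> set_pmf (K m) \<subseteq> S"
  shows "(\<Sum>m<M. measure_pmf.prob (K m) {y. g y = m}) / M * log 2 M - 1
     \<le> mutual_inf S (pmf_of_set {..<M}) K"
proof -
  let ?P = "pmf_of_set {..<M}" and ?I = "{..<M} \<times> S"
  let ?Q = "bind_pmf ?P K"
  have ne: "{..<M} \<noteq> {}" using M by (auto simp: lessThan_empty_iff)
  have sP: "set_pmf ?P = {..<M}" using ne by simp
  have Q: "set_pmf ?Q \<subseteq> S" using K ne by auto
  \<comment> \<open>\<open>q\<close> guesses the message from \<open>y\<close> as an even mixture of the decoder's answer and a uniform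
      guess; Gibbs' inequality against it replaces the usual entropy chain rule.\<close>
  define p where "p = (\<lambda>(m, y). pmf (K m) y / M)"
  define q where "q = (\<lambda>(m, y). pmf ?Q y * ((if g y = m then 1/2 else 0) + 1 / (2 * real M)))"
  have M0: "real M > 0" using M by simp
  have "0 \<le> kl ?I p q"
  proof (rule gibbs)
    fix x assume x: "x \<in> ?I"
    obtain m y where [simp]: "x = (m, y)" by force
    show "0 \<le> p x" "0 \<le> q x" by (auto simp: p_def q_def)
    assume "p x > 0"
    then have "pmf (K m) y > 0" using M0 by (auto simp: p_def zero_less_divide_iff)
    then have "pmf ?Q y > 0" using x ne by (intro pmf_bind_pos[of m]) auto
    then show "q x > 0" using M0 by (auto simp: q_def intro!: mult_pos_pos add_pos_pos)
  next
    have "sum q ?I = (\<Sum>y\<in>S. pmf ?Q y * (\<Sum>m<M. (if g y = m then 1/2 else 0) + 1 / (2 * real M)))"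
      unfolding q_def sum.cartesian_product[symmetric] by (subst sum.swap) (simp add: sum_distrib_left)
    also have "\<dots> \<le> (\<Sum>y\<in>S. pmf ?Q y * 1)"
      using M0 by (intro sum_mono mult_left_mono) (auto simp: sum.distrib)
    also have "\<dots> = 1" using sum_pmf_eq_1[OF S Q] by simp
    also have "\<dots> = sum p ?I" using M0 K S
      by (simp add: p_def sum_pmf_eq_1 flip: sum.cartesian_product sum_divide_distrib)
    finally show "sum q ?I \<le> sum p ?I" .
  qed
  also have "kl ?I p q = (\<Sum>m<M. \<Sum>y\<in>S. pmf (K m) y / M * log 2 (p (m, y) / q (m, y)))"
    unfolding kl_def by (simp add: sum.cartesian_product p_def case_prod_unfold)
  also have "\<dots> \<le> (\<Sum>m<M. \<Sum>y\<in>S. pmf (K m) y / M * (log 2 (pmf (K m) y / pmf ?Q y)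
       - (if g y = m then log 2 M else 0) + 1))"
  proof (intro sum_mono)
    fix m y assume m: "m \<in> {..<M}" and y: "y \<in> S"
    show "pmf (K m) y / M * log 2 (p (m, y) / q (m, y)) \<le> pmf (K m) y / M * (log 2 (pmf (K m) y / pmf ?Q y)
       - (if g y = m then log 2 M else 0) + 1)"
    proof (cases "pmf (K m) y = 0")
      case False
      then have k: "pmf (K m) y > 0" by (simp add: pmf_positive_iff set_pmf_iff)
      then have l: "pmf ?Q y > 0" using m ne by (intro pmf_bind_pos[of m]) auto
      \<comment> \<open>\<open>q (m, y)\<close> is \<open>pmf ?Q y * ?r / (2 * M)\<close>, and its
        \<open>M\<close> cancels against the one in \<open>p\<close>. The factor 2 is the bit lost
        in the statement; \<open>log 2 ?r\<close> is at least \<open>log 2 M\<close> on a correct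
        decision and 0 otherwise.\<close>
      let ?r = "(if g y = m then real M else 0) + 1" 
      have "p (m, y) / q (m, y) = (pmf (K m) y / pmf ?Q y) / (?r / 2)"
        using k l M0 by (auto simp: p_def q_def field_simps)
      then have "log 2 (p (m, y) / q (m, y)) = log 2 (pmf (K m) y / pmf ?Q y) - log 2 (?r / 2)"
        using k l M0 by (simp only:) (intro log_divide_pos, auto)
      also have "log 2 (?r / 2) = log 2 ?r - 1" using M0 by (subst log_divide_pos) auto
      finally have "log 2 (p (m, y) / q (m, y)) = log 2 (pmf (K m) y / pmf ?Q y) - (log 2 ?r - 1)" .
      moreover have "(if g y = m then log 2 M else 0) \<le> log 2 ?r" using M0 by auto
      ultimately have "log 2 (p (m, y) / q (m, y)) \<le> log 2 (pmf (K m) y / pmf ?Q y)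
          - (if g y = m then log 2 M else 0) + 1" by linarith
      then show ?thesis using M0 k by (intro mult_left_mono) auto
    qed simp
  qed
  also have "\<dots> = (\<Sum>m<M. kl S (pmf (K m)) (pmf ?Q) / M)
      - (\<Sum>m<M. (\<Sum>y\<in>S. if g y = m then pmf (K m) y else 0) / M * log 2 M) + (\<Sum>m<M. (\<Sum>y\<in>S. pmf (K m) y) / M)"
    unfolding kl_def sum_distrib_right sum_divide_distrib sum_subtractf[symmetric] sum.distrib[symmetric]
    by (intro sum.cong) (auto simp: algebra_simps add_divide_distrib diff_divide_distrib)
  also have "(\<Sum>m<M. (\<Sum>y\<in>S. pmf (K m) y) / M) = 1" using K S M0 by (simp add: sum_pmf_eq_1)
  also have "(\<Sum>m<M. (\<Sum>y\<in>S. if g y = m then pmf (K m) y else 0) / M * log 2 M) =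
      (\<Sum>m<M. measure_pmf.prob (K m) {y. g y = m} / M * log 2 M)"
  proof (intro sum.cong refl, goal_cases)
    case (1 m)
    have "measure_pmf.prob (K m) {y. g y = m} = measure_pmf.prob (K m) {y\<in>S. g y = m}"
      using K[of m] 1 by (intro measure_prob_cong_0) (auto simp: pmf_eq_0_set_pmf)
    also have "\<dots> = (\<Sum>y\<in>{y\<in>S. g y = m}. pmf (K m) y)"
      using S by (intro measure_measure_pmf_finite) auto
    also have "\<dots> = (\<Sum>y\<in>S. if g y = m then pmf (K m) y else 0)"
      using S by (rule sum.inter_filter)
    finally show ?case by simp
  qed
  finally show ?thesis
    unfolding mutual_inf_def sP using ne by (simp add: sum_divide_distrib sum_distrib_right)
qed

section \<open>Additive noise and degradation\<close>

lemma bxor_bxor: "bxor (bxor x y) = (\<lambda>z. bxor x (bxor y z))"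
  by (rule ext) (rule bxor_assoc)

text \<open>Convolution of two laws under bitwise addition modulo 2, with the noise as first
  argument. It serves both for channel outputs and, as \<open>noisy D W\<close>, for the sum of two
  noises.\<close>

definition noisy :: "bool list pmf \<Rightarrow> bool list pmf \<Rightarrow> bool list pmf" where
  "noisy W P = bind_pmf P (\<lambda>x. map_pmf (bxor x) W)"

lemma set_noisy: "set_pmf W \<subseteq> bits n \<Longrightarrow> set_pmf P \<subseteq> bits n \<Longrightarrow> set_pmf (noisy W P) \<subseteq> bits n"
  by (auto simp: noisy_def bits_def subset_iff)

lemma noisy_noisy: "noisy D (noisy W P) = noisy (noisy D W) P"
  by (simp add: noisy_def bind_assoc_pmf bind_map_pmf map_bind_pmf pmf.map_comp o_def bxor_bxor)

lemma noisy_bind: "noisy W (bind_pmf Q F) = bind_pmf Q (\<lambda>m. noisy W (F m))"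
  by (simp add: noisy_def bind_assoc_pmf)

lemma pmf_map_bxor:
  assumes "set_pmf W \<subseteq> bits n" "length x = n" "length z = n"
  shows "pmf (map_pmf (bxor x) W) z = pmf W (bxor x z)"
proof -
  have "pmf (map_pmf (bxor x) W) z = measure_pmf.prob W (bxor x -` {z})" by (rule pmf_map)
  also have "\<dots> = measure_pmf.prob W {bxor x z}"
    using assms by (intro measure_prob_cong_0) (auto simp: pmf_eq_0_set_pmf subset_iff)
  finally show ?thesis by (simp add: measure_pmf_single)
qed

lemma ent_map_bxor:
  assumes "set_pmf W \<subseteq> bits n" "length x = n"
  shows "ent (bits n) (pmf (map_pmf (bxor x) W)) = ent (bits n) (pmf W)"
  unfolding ent_def using sum_bits_bxor[of x n "\<lambda>z. pmf W z * log 2 (pmf W z)"] assms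
  by (simp add: pmf_map_bxor cong: sum.cong_simp)

lemma pmf_noisy:
  assumes "set_pmf W \<subseteq> bits n" "set_pmf P \<subseteq> bits n" "length z = n"
  shows "pmf (noisy W P) z = (\<Sum>x\<in>bits n. pmf P x * pmf W (bxor x z))"
  unfolding noisy_def using assms by (simp add: pmf_bind_finite[OF assms(2)] pmf_map_bxor)

text \<open>Entropy is minus the divergence from the counting measure, and convolution with
  \<open>D\<close> preserves that measure, so this is an instance of data processing.\<close>

lemma ent_noisy_ge:
  assumes "set_pmf D \<subseteq> bits n" "set_pmf P \<subseteq> bits n"
  shows "ent (bits n) (pmf P) \<le> ent (bits n) (pmf (noisy D P))"
proof -
  have "kl (bits n) (\<lambda>v. \<Sum>u\<in>bits n. pmf P u * pmf D (bxor u v)) (\<lambda>v. \<Sum>u\<in>bits n. 1 * pmf D (bxor u v))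
      \<le> kl (bits n) (pmf P) (\<lambda>_. 1)"
    using assms by (intro kl_data_processing) (auto simp: sum_bits_bxor sum_pmf_eq_1)
  moreover have "(\<Sum>u\<in>bits n. 1 * pmf D (bxor u v)) = 1" if "v \<in> bits n" for v
    using that assms sum_bits_bxor[of v n "pmf D"] by (simp add: bxor_commute[of _ v] sum_pmf_eq_1)
  ultimately have "kl (bits n) (pmf (noisy D P)) (\<lambda>_. 1) \<le> kl (bits n) (pmf P) (\<lambda>_. 1)"
    using assms unfolding kl_def by (simp add: pmf_noisy cong: sum.cong_simp)
  then show ?thesis by (simp add: ent_def kl_def)
qed

lemma ent_bits_le:
  assumes "set_pmf P \<subseteq> bits n"
  shows "ent (bits n) (pmf P) \<le> n"
proof -
  have "0 \<le> kl (bits n) (pmf P) (\<lambda>_. 1 / 2 ^ n)"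
    using assms by (intro gibbs) (simp_all add: card_bits sum_pmf_eq_1)
  also have "\<dots> = - ent (bits n) (pmf P) - (\<Sum>x\<in>bits n. pmf P x * log 2 (1 / 2 ^ n))"
    by (intro kl_eq_cross_entropy) auto
  also have "\<dots> = n - ent (bits n) (pmf P)"
    using assms by (simp add: sum_pmf_eq_1 log_divide_pos log_nat_power sum_negf flip: sum_distrib_right)
  finally show ?thesis by simp
qed

lemma mutual_inf_degraded:
  assumes Q: "finite (set_pmf Q)" and F: "\<And>m. m \<in> set_pmf Q \<Longrightarrow> set_pmf (F m) \<subseteq> bits n"
    and W: "set_pmf W \<subseteq> bits n" and D: "set_pmf D \<subseteq> bits n"
  shows "mutual_inf (bits n) Q (\<lambda>m. noisy W (F m)) \<le> mutual_inf (bits n) Q (\<lambda>m. noisy (noisy D W) (F m))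
     + ent (bits n) (pmf (noisy D W)) - ent (bits n) (pmf W)"
proof -
  let ?E = "\<lambda>P. ent (bits n) (pmf P)" and ?Z = "noisy D W"
  have Z: "set_pmf ?Z \<subseteq> bits n" using set_noisy D W by blast
  \<comment> \<open>A codeword only translates the noise and leaves its entropy unchanged. So the
    information between codeword and output is output entropy minus noise entropy, for every input
    law.\<close>
  have *: "mutual_inf (bits n) P (\<lambda>x. map_pmf (bxor x) V) = ?E (noisy V P) - ?E V"
    if "set_pmf P \<subseteq> bits n" "set_pmf V \<subseteq> bits n" for P V
  proof -
    have fin: "finite (set_pmf P)" using that finite_subset[OF _ finite_bits] by blast
    have "(\<Sum>m\<in>set_pmf P. pmf P m * ?E (map_pmf (bxor m) V)) = (\<Sum>m\<in>set_pmf P. pmf P m * ?E V)"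
      using that by (intro sum.cong) (auto simp: ent_map_bxor subset_iff)
    also have "\<dots> = ?E V" using fin by (simp add: sum_pmf_eq_1 flip: sum_distrib_right)
    finally show ?thesis by (simp add: mutual_inf_eq_ent[OF fin] noisy_def)
  qed
  \<comment> \<open>For one message, codeword, receiver output and degraded output form a Markov
    chain. Data processing for the information about the codeword, rewritten by \<open>*\<close>,
    compares the two output entropies given the message.\<close>
  have each: "?E (noisy ?Z (F m)) - ?E ?Z \<le> ?E (noisy W (F m)) - ?E W" if m: "m \<in> set_pmf Q" for m
  proof -
    have "mutual_inf (bits n) (F m) (\<lambda>x. bind_pmf (map_pmf (bxor x) W) (\<lambda>u. map_pmf (bxor u) D))
        \<le> mutual_inf (bits n) (F m) (\<lambda>x. map_pmf (bxor x) W)"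
      using F[OF m] W D finite_subset[OF _ finite_bits]
      by (intro mutual_inf_data_processing) (auto simp: subset_iff)
    moreover have "bind_pmf (map_pmf (bxor x) W) (\<lambda>u. map_pmf (bxor u) D) = map_pmf (bxor x) ?Z" for x
      by (simp add: noisy_def bind_map_pmf map_bind_pmf pmf.map_comp o_def bxor_bxor)
    ultimately show ?thesis using *[OF F[OF m] Z] *[OF F[OF m] W] by simp
  qed
  have "set_pmf (bind_pmf Q F) \<subseteq> bits n" using F by auto
  then have "set_pmf (noisy W (bind_pmf Q F)) \<subseteq> bits n" using W set_noisy by blast
  then have out: "?E (noisy W (bind_pmf Q F)) \<le> ?E (noisy ?Z (bind_pmf Q F))"
    using ent_noisy_ge[OF D] by (simp flip: noisy_noisy)
  have "(\<Sum>m\<in>set_pmf Q. pmf Q m * (?E (noisy ?Z (F m)) - ?E ?Z)) \<le>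
      (\<Sum>m\<in>set_pmf Q. pmf Q m * (?E (noisy W (F m)) - ?E W))"
    by (intro sum_mono mult_left_mono each) auto
  then have "(\<Sum>m\<in>set_pmf Q. pmf Q m * ?E (noisy ?Z (F m))) - ?E ?Z \<le>
      (\<Sum>m\<in>set_pmf Q. pmf Q m * ?E (noisy W (F m))) - ?E W"
    using Q by (simp add: right_diff_distrib sum_subtractf sum_pmf_eq_1 flip: sum_distrib_right)
  then show ?thesis using out by (simp add: mutual_inf_eq_ent[OF Q] noisy_bind)
qed

lemma bernoulli_degraded:
  assumes "0 \<le> p" "p \<le> p'" "p' \<le> 1/2"
  shows "\<exists>d. bernoulli_pmf p' = bind_pmf (bernoulli_pmf p) (\<lambda>a. map_pmf (\<lambda>c. a \<noteq> c) (bernoulli_pmf d))"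
proof -
  \<comment> \<open>The solution of \<open>p * (1 - d) + (1 - p) * d = p'\<close>. For
    \<open>p = 1/2\<close> the hypotheses force \<open>p' = 1/2\<close>, and the quotient 0/0
    evaluates to 0, which is the right value.\<close>
  define d where "d = (p' - p) / (1 - 2 * p)"
  have d: "0 \<le> d" "d \<le> 1" using assms by (auto simp: d_def divide_le_eq)
  have e: "p * (1 - d) + (1 - p) * d = p'"
  proof (cases "p = 1/2")
    case False
    then have "d * (1 - 2 * p) = p' - p" by (simp add: d_def)
    then show ?thesis by (simp add: algebra_simps)
  next
    case True
    then have "p' = 1/2" using assms by simp
    then have "d = 0" using True by (simp add: d_def)
    then show ?thesis using True \<open>p' = 1/2\<close> by simp
  qed
  have "pmf (map_pmf Not (bernoulli_pmf d)) (\<not> c) = pmf (bernoulli_pmf d) c" for c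
    by (rule pmf_map_inj') (auto simp: inj_def)
  from this[of True] this[of False]
  have n: "pmf (map_pmf Not (bernoulli_pmf d)) True = 1 - d" "pmf (map_pmf Not (bernoulli_pmf d)) False = d"
    using d by simp_all
  show ?thesis
  proof (intro exI[of _ d] pmf_eqI)
    fix b
    show "pmf (bernoulli_pmf p') b =
        pmf (bind_pmf (bernoulli_pmf p) (\<lambda>a. map_pmf (\<lambda>c. a \<noteq> c) (bernoulli_pmf d))) b"
      using assms d e by (cases b) (simp add: pmf_bind map_pmf_ident n, simp add: algebra_simps)+
  qed
qed

lemma bern_list_degraded:
  assumes "list_all2 (\<lambda>p p'. 0 \<le> p \<and> p \<le> p' \<and> p' \<le> 1/2) ps ps'"
  shows "\<exists>ds. length ds = length ps \<and> bern_list ps' = noisy (bern_list ds) (bern_list ps)"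
  using assms
proof (induction rule: list_all2_induct)
  case Nil
  then show ?case by (simp add: noisy_def)
next
  case (Cons p ps p' ps')
  obtain d where d: "bernoulli_pmf p' = bind_pmf (bernoulli_pmf p) (\<lambda>a. map_pmf (\<lambda>c. a \<noteq> c) (bernoulli_pmf d))"
    using bernoulli_degraded Cons by blast
  obtain ds where ds: "length ds = length ps" "bern_list ps' = noisy (bern_list ds) (bern_list ps)"
    using Cons by blast
  have "bern_list (p' # ps') = noisy (bern_list (d # ds)) (bern_list (p # ps))"
    \<comment> \<open>The two sides draw bits in different orders: the extra flip with parameter
      \<open>d\<close> comes before the remaining bits of \<open>ps\<close> on the left and after
      them on the right.\<close>
    by (simp add: d ds noisy_def map_pmf_def bind_assoc_pmf bind_return_pmf)
       (subst bind_commute_pmf[of "bernoulli_pmf d"], rule refl)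
  then show ?case using ds(1) by (intro exI[of _ "d # ds"]) simp
qed

section \<open>Moments and entropy of independent bits\<close>

lemma bern_list_first_moment:
  assumes "\<And>p. p \<in> set ps \<Longrightarrow> 0 \<le> p \<and> p \<le> 1"
  shows "(\<Sum>e\<in>bits (length ps). pmf (bern_list ps) e * sum_list (map2 \<phi> ps e))
     = sum_list (map (\<lambda>p. p * \<phi> p True + (1 - p) * \<phi> p False) ps)"
  using assms
proof (induction ps)
  case (Cons p ps)
  have "(\<Sum>e\<in>bits (length (p # ps)). pmf (bern_list (p # ps)) e * sum_list (map2 \<phi> (p # ps) e))
     = (\<Sum>e\<in>bits (length ps). (p * \<phi> p True + (1 - p) * \<phi> p False) * pmf (bern_list ps) e
          + pmf (bern_list ps) e * sum_list (map2 \<phi> ps e))"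
    using Cons.prems by (simp add: sum_bits_Suc pmf_bern_list_Cons del: bern_list.simps)
      (auto simp: algebra_simps intro!: sum.cong)
  also have "\<dots> = (p * \<phi> p True + (1 - p) * \<phi> p False) + sum_list (map (\<lambda>p. p * \<phi> p True + (1 - p) * \<phi> p False) ps)"
    using Cons by (simp add: sum.distrib sum_pmf_eq_1 set_bern_list flip: sum_distrib_left)
  finally show ?case by simp
qed (simp add: bits_0)

text \<open>Variance of a sum of independent centred terms: in the induction the cross term carries
  the factor \<open>?m\<close>, the mean of the new summand, which is 0.\<close>

lemma bern_list_second_moment:
  assumes "\<And>p. p \<in> set ps \<Longrightarrow> 0 \<le> p \<and> p \<le> 1"
    and "\<And>p. p \<in> set ps \<Longrightarrow> p * \<phi> p True + (1 - p) * \<phi> p False = 0"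
  shows "(\<Sum>e\<in>bits (length ps). pmf (bern_list ps) e * (sum_list (map2 \<phi> ps e))\<^sup>2)
     = sum_list (map (\<lambda>p. p * (\<phi> p True)\<^sup>2 + (1 - p) * (\<phi> p False)\<^sup>2) ps)"
  using assms
proof (induction ps)
  case (Cons p ps)
  let ?m = "p * \<phi> p True + (1 - p) * \<phi> p False"
  let ?v = "p * (\<phi> p True)\<^sup>2 + (1 - p) * (\<phi> p False)\<^sup>2"
  have "(\<Sum>e\<in>bits (length (p # ps)). pmf (bern_list (p # ps)) e * (sum_list (map2 \<phi> (p # ps) e))\<^sup>2)
     = (\<Sum>e\<in>bits (length ps). ?v * pmf (bern_list ps) e
          + (2 * ?m) * (pmf (bern_list ps) e * sum_list (map2 \<phi> ps e))
          + pmf (bern_list ps) e * (sum_list (map2 \<phi> ps e))\<^sup>2)"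
    using Cons.prems(1)[of p] by (simp add: sum_bits_Suc pmf_bern_list_Cons del: bern_list.simps)
      (auto simp: algebra_simps power2_eq_square intro!: sum.cong)
  also have "\<dots> = ?v + 0 + sum_list (map (\<lambda>p. p * (\<phi> p True)\<^sup>2 + (1 - p) * (\<phi> p False)\<^sup>2) ps)"
    using Cons by (simp add: sum.distrib sum_pmf_eq_1 set_bern_list flip: sum_distrib_left)
  finally show ?case by simp
qed (simp add: bits_0)

text \<open>Positivity is essential: for an impossible string the left-hand side is
  \<open>log 2 0 = 0\<close>, while the possible bits still contribute to the sum.\<close>

lemma log_pmf_bern_list:
  assumes "\<And>p. p \<in> set ps \<Longrightarrow> 0 \<le> p \<and> p \<le> 1" "pmf (bern_list ps) e > 0"
  shows "log 2 (pmf (bern_list ps) e) = sum_list (map2 (\<lambda>p b. log 2 (if b then p else 1 - p)) ps e)"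
  using assms
proof (induction ps arbitrary: e)
  case Nil
  then show ?case by (cases e) (auto simp: indicator_def)
next
  case (Cons p ps)
  then have "e \<in> bits (length (p # ps))"
    using set_bern_list[of "p # ps"] unfolding pmf_positive_iff by blast
  then obtain b bs where e: "e = b # bs" by (cases e) auto
  let ?w = "if b then p else 1 - p"
  have eq: "pmf (bern_list (p # ps)) e = ?w * pmf (bern_list ps) bs"
    unfolding e using Cons.prems by (intro pmf_bern_list_Cons) auto
  have w: "?w > 0" "pmf (bern_list ps) bs > 0"
    using Cons.prems unfolding eq by (auto simp: zero_less_mult_iff split: if_splits)
  show ?case unfolding eq using w Cons by (subst log_mult_pos) (auto simp: e)
qed

lemma ent_bern_list:
  assumes "\<And>p. p \<in> set ps \<Longrightarrow> 0 \<le> p \<and> p \<le> 1"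
  shows "ent (bits (length ps)) (pmf (bern_list ps)) = sum_list (map bin_entropy ps)"
proof -
  let ?\<phi> = "\<lambda>p b. - log 2 (if b then p else 1 - p)"
  have neg: "sum_list (map2 ?\<phi> ps e) = - sum_list (map2 (\<lambda>p b. log 2 (if b then p else 1 - p)) ps e)" for e
    by (induction ps e rule: list_induct2') auto
  have "ent (bits (length ps)) (pmf (bern_list ps)) = 
     (\<Sum>e\<in>bits (length ps). pmf (bern_list ps) e * sum_list (map2 ?\<phi> ps e))"
    unfolding ent_def sum_negf[symmetric]
  proof (rule sum.cong)
    fix e
    show "- (pmf (bern_list ps) e * log 2 (pmf (bern_list ps) e)) =
        pmf (bern_list ps) e * sum_list (map2 ?\<phi> ps e)"
    proof (cases "pmf (bern_list ps) e = 0")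
      case False
      then have "pmf (bern_list ps) e > 0" by (simp add: pmf_positive)
      then show ?thesis unfolding neg using log_pmf_bern_list[OF assms] by simp
    qed simp
  qed simp
  also have "\<dots> = sum_list (map bin_entropy ps)"
    by (subst bern_list_first_moment[OF assms]) (auto intro!: arg_cong[where f = sum_list] simp: bin_entropy_def)
  finally show ?thesis .
qed

text \<open>The \<open>N\<close> positions of a block share its state. This turns sums over symbols
  into sums over block states, for the entropy as well as for the variance.\<close>

lemma sum_list_xover:
  assumes "length s = B"
  shows "sum_list (map (\<lambda>i. F (xover pa pb N s i)) [0..<N*B]) = real N * sum_list (map (\<lambda>b. if b then F pa else F pb) s)"
proof -
  have "sum_list (map (\<lambda>i. F (xover pa pb N s i)) [0..<N*B]) = (\<Sum>i<B*N. F (xover pa pb N s i))"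
    by (simp add: interv_sum_list_conv_sum_set_nat atLeast0LessThan mult.commute)
  also have "\<dots> = (\<Sum>k<B. \<Sum>i\<in>{k*N..<k*N+N}. F (xover pa pb N s i))"
    by (rule sum.nat_group[symmetric])
  also have "\<dots> = (\<Sum>k<B. real N * (if s ! k then F pa else F pb))"
  proof (rule sum.cong)
    fix k
    have "F (xover pa pb N s i) = (if s ! k then F pa else F pb)" if "i \<in> {k*N..<k*N+N}" for i
    proof -
      have "i div N = k" using that by (intro div_nat_eqI) (auto simp: mult.commute)
      then show ?thesis by (simp add: xover_def)
    qed
    then show "(\<Sum>i\<in>{k*N..<k*N+N}. F (xover pa pb N s i)) = real N * (if s ! k then F pa else F pb)"
      by simp
  qed simp
  also have "\<dots> = real N * sum_list (map (\<lambda>b. if b then F pa else F pb) s)"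
    using assms by (simp add: sum_list_sum_nth atLeast0LessThan sum_distrib_left)
  finally show ?thesis .
qed

section \<open>The wiretap model\<close>

lemma pmf_bind_Pair:
  "pmf (bind_pmf P (\<lambda>x. map_pmf (Pair x) (F x))) (a, b) = pmf P a * pmf (F a) b"
proof -
  have *: "pmf (map_pmf (Pair x) (F x)) (a, b) = (if x = a then pmf (F a) b else 0)" for x
    using pmf_map_inj'[of "Pair x" "F x" b] by (auto simp: pmf_eq_0_set_pmf inj_def)
  show ?thesis unfolding pmf_bind * by (subst integral_measure_pmf_real[of "{a}"]) (auto split: if_splits)
qed

lemma pmf_bind_Pair':
  "pmf (bind_pmf P (\<lambda>x. map_pmf (\<lambda>y. (y, x)) (F x))) (b, a) = pmf P a * pmf (F a) b"
proof -
  have "bind_pmf P (\<lambda>x. map_pmf (\<lambda>y. (y, x)) (F x)) =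
     map_pmf prod.swap (bind_pmf P (\<lambda>x. map_pmf (Pair x) (F x)))"
    by (simp add: map_bind_pmf pmf.map_comp o_def)
  also have "pmf \<dots> (prod.swap (a, b)) = pmf (bind_pmf P (\<lambda>x. map_pmf (Pair x) (F x))) (a, b)"
    by (rule pmf_map_inj') simp
  finally show ?thesis by (simp add: pmf_bind_Pair)
qed

text \<open>The view of a single observer: message, output, states. Receiver and eavesdropper each
  have a view of this shape, and \<open>wt_err\<close> and \<open>wt_leak\<close> each depend on one
  of the two.\<close>

definition joint :: "nat \<Rightarrow> 's pmf \<Rightarrow> (nat \<Rightarrow> 's \<Rightarrow> 'z pmf) \<Rightarrow> (nat \<times> 'z \<times> 's) pmf" where
  "joint M T K = do {m \<leftarrow> pmf_of_set {..<M}; t \<leftarrow> T; z \<leftarrow> K m t; return_pmf (m, z, t)}"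

lemma pmf_joint: "pmf (joint M T K) (m, z, t) = pmf (pmf_of_set {..<M}) m * (pmf T t * pmf (K m t) z)"
proof -
  have "joint M T K = bind_pmf (pmf_of_set {..<M})
      (\<lambda>m. map_pmf (Pair m) (bind_pmf T (\<lambda>t. map_pmf (\<lambda>z. (z, t)) (K m t))))"
    by (simp add: joint_def map_pmf_def bind_assoc_pmf bind_return_pmf)
  then show ?thesis by (simp only: pmf_bind_Pair pmf_bind_Pair')
qed

lemma prob_joint:
  assumes "M \<ge> 1" "finite (set_pmf T)"
  shows "measure_pmf.prob (joint M T K) E =
     (\<Sum>t\<in>set_pmf T. pmf T t * ((\<Sum>m<M. measure_pmf.prob (K m t) {z. (m, z, t) \<in> E}) / M))"
proof -
  have ne: "{..<M} \<noteq> {}" using assms by (auto simp: lessThan_empty_iff)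
  have "measure_pmf.prob (joint M T K) E = pmf (map_pmf (\<lambda>\<omega>. \<omega> \<in> E) (joint M T K)) True"
    by (simp add: pmf_map vimage_def)
  also have "map_pmf (\<lambda>\<omega>. \<omega> \<in> E) (joint M T K) = bind_pmf T (\<lambda>t. bind_pmf (pmf_of_set {..<M})
      (\<lambda>m. map_pmf (\<lambda>z. (m, z, t) \<in> E) (K m t)))"
    unfolding joint_def by (subst bind_commute_pmf) (simp add: map_pmf_def bind_assoc_pmf bind_return_pmf)
  also have "pmf \<dots> True = (\<Sum>t\<in>set_pmf T. pmf T t * ((\<Sum>m<M. measure_pmf.prob (K m t) {z. (m, z, t) \<in> E}) / M))"
    using ne by (simp add: pmf_bind_finite[OF order_refl assms(2)] pmf_bind_finite[of _ "{..<M}"]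
        pmf_map vimage_def sum_divide_distrib)
  finally show ?thesis .
qed

text \<open>Message and states are independent, so in the logarithm of \<open>cond_mi\<close> the
  weights of \<open>m\<close> and \<open>t\<close> cancel and leave the ratio of
  \<open>K m t\<close> to the output law given \<open>t\<close>.\<close>

lemma cond_mi_joint:
  assumes M: "M \<ge> 1" and T: "finite (set_pmf T)" and S: "finite S"
    and K: "\<And>m t. m < M \<Longrightarrow> t \<in> set_pmf T \<Longrightarrow> set_pmf (K m t) \<subseteq> S"
  shows "cond_mi (joint M T K) = 
     (\<Sum>t\<in>set_pmf T. pmf T t * mutual_inf S (pmf_of_set {..<M}) (\<lambda>m. K m t))"
proof -
  let ?J = "joint M T K" and ?P = "pmf_of_set {..<M}"
  let ?A = "{..<M} \<times> S \<times> set_pmf T"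
  define Q where "Q = (\<lambda>t. bind_pmf ?P (\<lambda>m. K m t))"
  have M0: "real M > 0" using M by simp
  have ne: "{..<M} \<noteq> {}" using M by (auto simp: lessThan_empty_iff)
  have P: "pmf ?P m = 1 / M" if "m < M" for m using that ne by simp
  have c: "map_pmf (\<lambda>(a, b, c). c) ?J = T"
    by (simp add: joint_def map_bind_pmf bind_return_pmf')
  have "map_pmf (\<lambda>(a, b, c). (a, c)) ?J = bind_pmf ?P (\<lambda>m. map_pmf (Pair m) T)"
    by (simp add: joint_def map_bind_pmf map_pmf_def bind_assoc_pmf bind_return_pmf)
  then have ac: "pmf (map_pmf (\<lambda>(a, b, c). (a, c)) ?J) (m, t) = pmf ?P m * pmf T t" for m t
    by (simp only: pmf_bind_Pair)
  have "map_pmf (\<lambda>(a, b, c). (b, c)) ?J = bind_pmf T (\<lambda>t. map_pmf (\<lambda>z. (z, t)) (Q t))"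
    unfolding joint_def Q_def
    by (subst bind_commute_pmf) (simp add: map_bind_pmf map_pmf_def bind_assoc_pmf bind_return_pmf)
  then have bc: "pmf (map_pmf (\<lambda>(a, b, c). (b, c)) ?J) (z, t) = pmf T t * pmf (Q t) z" for z t
    by (simp only: pmf_bind_Pair')
  have sub: "set_pmf ?J \<subseteq> ?A" using K ne by (auto simp: joint_def)
  have "cond_mi ?J = (\<Sum>x\<in>?A. case x of (m, z, t) \<Rightarrow> pmf T t * (pmf ?P m * (pmf (K m t) z * log 2 (pmf (K m t) z / pmf (Q t) z))))"
    unfolding cond_mi_def
  proof (rule sum.mono_neutral_cong_left)
    show "\<forall>x\<in>?A - set_pmf ?J. (case x of (m, z, t) \<Rightarrow> pmf T t * (pmf ?P m * (pmf (K m t) z * log 2 (pmf (K m t) z / pmf (Q t) z)))) = 0"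
      by (auto simp: pmf_eq_0_set_pmf[symmetric] pmf_joint simp del: pmf_of_set)
  next
    fix x assume x: "x \<in> set_pmf ?J"
    obtain m z t where x_eq: "x = (m, z, t)" by (cases x)
    have "pmf ?J (m, z, t) > 0" using x x_eq by (simp add: pmf_positive)
    then have pos: "pmf ?P m > 0" "pmf T t > 0" "pmf (K m t) z > 0"
      by (auto simp: pmf_joint zero_less_mult_iff simp del: pmf_of_set)
    have q: "pmf (Q t) z > 0" unfolding Q_def using pos by (intro pmf_bind_pos[of m]) (auto simp: pmf_positive_iff)
    show "(case x of (a, b, c) \<Rightarrow> pmf ?J (a, b, c) * log 2 ((pmf ?J (a, b, c) * pmf (map_pmf (\<lambda>(a, b, c). c) ?J) c) /
        (pmf (map_pmf (\<lambda>(a, b, c). (a, c)) ?J) (a, c) * pmf (map_pmf (\<lambda>(a, b, c). (b, c)) ?J) (b, c)))) =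
      (case x of (m, z, t) \<Rightarrow> pmf T t * (pmf ?P m * (pmf (K m t) z * log 2 (pmf (K m t) z / pmf (Q t) z))))"
      unfolding x_eq prod.case c ac bc pmf_joint using pos q by (simp del: pmf_of_set)
  qed (use sub T S in auto)
  also have "\<dots> = (\<Sum>t\<in>set_pmf T. pmf T t * (\<Sum>m<M. pmf ?P m * (\<Sum>z\<in>S. pmf (K m t) z * log 2 (pmf (K m t) z / pmf (Q t) z))))"
    unfolding sum.cartesian_product[symmetric] sum_distrib_left
    by (subst (2) sum.swap, subst sum.swap) simp
  finally show ?thesis using ne by (simp add: mutual_inf_def kl_def Q_def)
qed

definition states :: "nat \<Rightarrow> real \<Rightarrow> real \<Rightarrow> (bool list \<times> bool list) pmf" where
  "states B q1 q1s = pair_pmf (bern_list (replicate B q1)) (bern_list (replicate B q1s))"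

lemma set_states: "set_pmf (states B q1 q1s) \<subseteq> bits B \<times> bits B"
  using set_bern_list[of "replicate B q1"] set_bern_list[of "replicate B q1s"] by (auto simp: states_def)

lemma finite_set_states: "finite (set_pmf (states B q1 q1s))"
  by (rule finite_subset[OF set_states]) simp

lemma set_bf_noise: "set_pmf (bf_noise pa pb N B s) \<subseteq> bits (N * B)"
  using set_bern_list[of "map (xover pa pb N s) [0..<N*B]"] by (simp add: bf_noise_def)

lemma wt_joint_main:
  "map_pmf (\<lambda>(m, st, x, y, z). (m, y, st)) (wt_joint q1 q1s p1 p2 p1s p2s N B M f) =
     joint M (states B q1 q1s) (\<lambda>m t. noisy (bf_noise p1 p2 N B (fst t)) (f m))"
  by (simp add: wt_joint_def joint_def states_def pair_pmf_def noisy_def bxor_def[abs_def]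
      map_pmf_def bind_assoc_pmf bind_return_pmf)

lemma wt_joint_eve:
  "map_pmf (\<lambda>(m, st, x, y, z). (m, z, st)) (wt_joint q1 q1s p1 p2 p1s p2s N B M f) =
     joint M (states B q1 q1s) (\<lambda>m t. noisy (bf_noise p1s p2s N B (snd t)) (f m))"
  by (simp add: wt_joint_def joint_def states_def pair_pmf_def noisy_def bxor_def[abs_def]
      map_pmf_def bind_assoc_pmf bind_return_pmf)

lemma wt_leak_eq:
  assumes "M \<ge> 1" "\<And>m. m < M \<Longrightarrow> set_pmf (f m) \<subseteq> bits (N * B)"
  shows "wt_leak q1 q1s p1 p2 p1s p2s N B M f = (\<Sum>t\<in>set_pmf (states B q1 q1s). pmf (states B q1 q1s) t *
     mutual_inf (bits (N * B)) (pmf_of_set {..<M}) (\<lambda>m. noisy (bf_noise p1s p2s N B (snd t)) (f m)))"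
  unfolding wt_leak_def wt_joint_eve using assms set_bf_noise
  by (intro cond_mi_joint finite_set_states set_noisy) auto

lemma wt_err_eq:
  assumes "M \<ge> 1"
  shows "wt_err q1 q1s p1 p2 p1s p2s N B M f g = (\<Sum>t\<in>set_pmf (states B q1 q1s). pmf (states B q1 q1s) t *
     ((\<Sum>m<M. measure_pmf.prob (noisy (bf_noise p1 p2 N B (fst t)) (f m)) {y. g y t \<noteq> m}) / M))"
proof -
  have "wt_err q1 q1s p1 p2 p1s p2s N B M f g =
    measure_pmf.prob (map_pmf (\<lambda>(m, st, x, y, z). (m, y, st)) (wt_joint q1 q1s p1 p2 p1s p2s N B M f)) {(m, y, st). g y st \<noteq> m}"
    unfolding wt_err_def measure_map_pmf by (rule arg_cong2[where f = measure]) auto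
  then show ?thesis unfolding wt_joint_main by (simp add: prob_joint[OF assms finite_set_states])
qed

section \<open>Converse\<close>

lemma sum_states:
  "(\<Sum>t\<in>set_pmf (states B q1 q1s). pmf (states B q1 q1s) t * F t) =
    (\<Sum>s\<in>bits B. \<Sum>ss\<in>bits B. pmf (bern_list (replicate B q1)) s * (pmf (bern_list (replicate B q1s)) ss * F (s, ss)))"
proof -
  have "(\<Sum>t\<in>set_pmf (states B q1 q1s). pmf (states B q1 q1s) t * F t) =
     (\<Sum>t\<in>bits B \<times> bits B. pmf (states B q1 q1s) t * F t)"
    using set_states by (intro sum.mono_neutral_left) (auto simp: pmf_eq_0_set_pmf simp del: in_bits_iff)
  also have "\<dots> = (\<Sum>s\<in>bits B. \<Sum>ss\<in>bits B. pmf (states B q1 q1s) (s, ss) * F (s, ss))"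
    by (simp add: sum.cartesian_product)
  finally show ?thesis by (simp add: states_def pmf_pair mult.assoc)
qed

lemma sum_pmf_bern_list: "(\<Sum>s\<in>bits (length ps). pmf (bern_list ps) s) = 1"
  by (intro sum_pmf_eq_1 set_bern_list) simp

lemma sum_pmf_bern_list_replicate: "(\<Sum>s\<in>bits B. pmf (bern_list (replicate B q)) s) = 1"
  using sum_pmf_bern_list[of "replicate B q"] by simp

lemma sum_states_fst:
  "(\<Sum>t\<in>set_pmf (states B q1 q1s). pmf (states B q1 q1s) t * F (fst t)) =
    (\<Sum>s\<in>bits B. pmf (bern_list (replicate B q1)) s * F s)"
proof -
  have "(\<Sum>ss\<in>bits B. a * (pmf (bern_list (replicate B q1s)) ss * b)) = a * b" for a b
  proof -
    have "(\<Sum>ss\<in>bits B. a * (pmf (bern_list (replicate B q1s)) ss * b)) =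
        a * ((\<Sum>ss\<in>bits B. pmf (bern_list (replicate B q1s)) ss) * b)"
      by (simp only: sum_distrib_left sum_distrib_right)
    then show ?thesis by (simp add: sum_pmf_bern_list_replicate)
  qed
  then show ?thesis by (simp add: sum_states)
qed

lemma sum_states_snd:
  "(\<Sum>t\<in>set_pmf (states B q1 q1s). pmf (states B q1 q1s) t * F (snd t)) =
    (\<Sum>s\<in>bits B. pmf (bern_list (replicate B q1s)) s * F s)"
  unfolding sum_states snd_conv sum_product[symmetric] by (simp add: sum_pmf_bern_list_replicate)

text \<open>The ordering of the four crossover probabilities enters here: at each position the
  receiver's parameter is at most the eavesdropper's, whatever the states \<open>s\<close> and
  \<open>ss\<close> are.\<close>

lemma bf_noise_degraded:
  assumes "0 \<le> p1" "p1 \<le> p2" "p2 \<le> p1s" "p1s \<le> p2s" "p2s \<le> 1/2"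
  shows "\<exists>D. set_pmf D \<subseteq> bits (N * B) \<and> bf_noise p1s p2s N B ss = noisy D (bf_noise p1 p2 N B s)"
proof -
  have "list_all2 (\<lambda>p p'. 0 \<le> p \<and> p \<le> p' \<and> p' \<le> 1/2) (map (xover p1 p2 N s) [0..<N*B]) (map (xover p1s p2s N ss) [0..<N*B])"
    using assms by (auto simp: list_all2_conv_all_nth xover_def)
  from bern_list_degraded[OF this]
  obtain ds where "length ds = N * B" "bf_noise p1s p2s N B ss = noisy (bern_list ds) (bf_noise p1 p2 N B s)"
    unfolding bf_noise_def by auto
  then show ?thesis using set_bern_list[of ds] by auto
qed

lemma ent_bf_noise:
  assumes "0 \<le> pa" "pa \<le> 1" "0 \<le> pb" "pb \<le> 1" "length s = B"
  shows "ent (bits (N * B)) (pmf (bf_noise pa pb N B s)) =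
     real N * sum_list (map (\<lambda>b. if b then bin_entropy pa else bin_entropy pb) s)"
proof -
  have "ent (bits (N * B)) (pmf (bf_noise pa pb N B s)) = sum_list (map (\<lambda>i. bin_entropy (xover pa pb N s i)) [0..<N*B])"
    using ent_bern_list[of "map (xover pa pb N s) [0..<N*B]"] assms
    by (auto simp: bf_noise_def xover_def o_def)
  then show ?thesis using assms(5) by (simp only: sum_list_xover)
qed

lemma mean_state_sum:
  assumes "0 \<le> q" "q \<le> 1"
  shows "(\<Sum>s\<in>bits B. pmf (bern_list (replicate B q)) s * sum_list (map F s)) = real B * (q * F True + (1 - q) * F False)"
proof -
  have "map2 (\<lambda>_. F) (replicate B q) s = map F s" if "length s = B" for s
    using that by (simp add: zip_replicate1 o_def)
  then have "(\<Sum>s\<in>bits B. pmf (bern_list (replicate B q)) s * sum_list (map F s)) =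
     (\<Sum>s\<in>bits B. pmf (bern_list (replicate B q)) s * sum_list (map2 (\<lambda>_. F) (replicate B q) s))"
    by (intro sum.cong) auto
  also have "\<dots> = real B * (q * F True + (1 - q) * F False)"
    using bern_list_first_moment[of "replicate B q" "\<lambda>_. F"] assms
    by (simp add: sum_list_replicate)
  finally show ?thesis .
qed

lemma mean_ent_bf_noise:
  assumes "0 \<le> pa" "pa \<le> 1" "0 \<le> pb" "pb \<le> 1" "0 \<le> q" "q \<le> 1"
  shows "(\<Sum>s\<in>bits B. pmf (bern_list (replicate B q)) s * ent (bits (N * B)) (pmf (bf_noise pa pb N B s))) =
    real (N * B) * (q * bin_entropy pa + (1 - q) * bin_entropy pb)"
proof -
  have "(\<Sum>s\<in>bits B. pmf (bern_list (replicate B q)) s * ent (bits (N * B)) (pmf (bf_noise pa pb N B s))) =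
    real N * (\<Sum>s\<in>bits B. pmf (bern_list (replicate B q)) s * sum_list (map (\<lambda>b. if b then bin_entropy pa else bin_entropy pb) s))"
    unfolding sum_distrib_left using assms by (intro sum.cong) (auto simp: ent_bf_noise)
  then show ?thesis using assms by (simp add: mean_state_sum)
qed

text \<open>Fano's inequality and \<open>mutual_inf_degraded\<close> hold for each state realization
  \<open>t\<close>; averaging over \<open>t\<close> turns the noise entropies into the capacity
  formula, for every finite \<open>N\<close> and \<open>B\<close>.\<close>

lemma converse_bound:
  assumes q: "0 \<le> q1" "q1 \<le> 1" "0 \<le> q1s" "q1s \<le> 1"
    and p: "0 \<le> p1" "p1 \<le> p2" "p2 \<le> p1s" "p1s \<le> p2s" "p2s \<le> 1/2"
    and M: "M \<ge> 1" and f: "\<And>m. m < M \<Longrightarrow> set_pmf (f m) \<subseteq> bits (N * B)"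
  shows "(1 - wt_err q1 q1s p1 p2 p1s p2s N B M f g) * log 2 M - 1 \<le> wt_leak q1 q1s p1 p2 p1s p2s N B M f
     + real (N * B) * (q1s * bin_entropy p1s + (1 - q1s) * bin_entropy p2s
       - q1 * bin_entropy p1 - (1 - q1) * bin_entropy p2)"
proof -
  define n where "n = N * B"
  let ?T = "states B q1 q1s" and ?P = "pmf_of_set {..<M}"
  let ?Y = "\<lambda>t. bf_noise p1 p2 N B (fst t)" and ?Z = "\<lambda>t. bf_noise p1s p2s N B (snd t)"
  have ne: "{..<M} \<noteq> {}" using M by (auto simp: lessThan_empty_iff)
  have M0: "real M > 0" using M by simp
  have f': "set_pmf (f m) \<subseteq> bits n" if "m < M" for m using f[OF that] by (simp add: n_def)
  have noise: "set_pmf (bf_noise pa pb N B s) \<subseteq> bits n" for pa pb s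
    using set_bf_noise by (simp add: n_def)
  define c where "c = (\<lambda>t. (\<Sum>m<M. measure_pmf.prob (noisy (?Y t) (f m)) {y. g y t = m}) / M)"
  have c: "(\<Sum>m<M. measure_pmf.prob (noisy (?Y t) (f m)) {y. g y t \<noteq> m}) / M = 1 - c t" for t
  proof -
    have "measure_pmf.prob (noisy (?Y t) (f m)) {y. g y t \<noteq> m} = 
       1 - measure_pmf.prob (noisy (?Y t) (f m)) {y. g y t = m}" for m
      using measure_pmf.prob_compl[of "{y. g y t = m}" "noisy (?Y t) (f m)"]
      by (simp add: Compl_eq_Diff_UNIV[symmetric] Collect_neg_eq[symmetric])
    then show ?thesis using M0 by (simp add: c_def sum_subtractf diff_divide_distrib)
  qed
  have one: "(\<Sum>t\<in>set_pmf ?T. pmf ?T t) = 1" using finite_set_states by (intro sum_pmf_eq_1) auto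
  have each: "c t * log 2 M - 1 \<le> mutual_inf (bits n) ?P (\<lambda>m. noisy (?Z t) (f m))
      + ent (bits n) (pmf (?Z t)) - ent (bits n) (pmf (?Y t))" for t
  proof -
    obtain D where D: "set_pmf D \<subseteq> bits n" "?Z t = noisy D (?Y t)"
      using bf_noise_degraded[OF p] unfolding n_def by blast
    have "c t * log 2 M - 1 \<le> mutual_inf (bits n) ?P (\<lambda>m. noisy (?Y t) (f m))"
      unfolding c_def by (intro fano_inequality M finite_bits set_noisy noise f')
    also have "\<dots> \<le> mutual_inf (bits n) ?P (\<lambda>m. noisy (?Z t) (f m))
      + ent (bits n) (pmf (?Z t)) - ent (bits n) (pmf (?Y t))"
      unfolding D(2) using ne f' noise D(1) by (intro mutual_inf_degraded) auto
    finally show ?thesis .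
  qed
  have leak: "wt_leak q1 q1s p1 p2 p1s p2s N B M f = (\<Sum>t\<in>set_pmf ?T. pmf ?T t *
      mutual_inf (bits n) ?P (\<lambda>m. noisy (?Z t) (f m)))"
    unfolding n_def by (rule wt_leak_eq[OF M f])
  have "(1 - wt_err q1 q1s p1 p2 p1s p2s N B M f g) * log 2 M - 1 = (\<Sum>t\<in>set_pmf ?T. pmf ?T t * (c t * log 2 M - 1))"
    unfolding wt_err_eq[OF M] c using one by (simp add: right_diff_distrib sum_subtractf sum_distrib_right mult.assoc)
  also have "\<dots> \<le> (\<Sum>t\<in>set_pmf ?T. pmf ?T t * (mutual_inf (bits n) ?P (\<lambda>m. noisy (?Z t) (f m))
      + ent (bits n) (pmf (?Z t)) - ent (bits n) (pmf (?Y t))))"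
    by (intro sum_mono mult_left_mono each) auto
  also have "\<dots> = wt_leak q1 q1s p1 p2 p1s p2s N B M f
     + (\<Sum>t\<in>set_pmf ?T. pmf ?T t * ent (bits n) (pmf (?Z t))) - (\<Sum>t\<in>set_pmf ?T. pmf ?T t * ent (bits n) (pmf (?Y t)))"
    unfolding leak by (simp add: right_diff_distrib distrib_left sum.distrib sum_subtractf)
  also have "(\<Sum>t\<in>set_pmf ?T. pmf ?T t * ent (bits n) (pmf (?Z t))) =
      real n * (q1s * bin_entropy p1s + (1 - q1s) * bin_entropy p2s)"
    unfolding sum_states_snd[of B q1 q1s "\<lambda>s. ent (bits n) (pmf (bf_noise p1s p2s N B s))"]
    unfolding n_def by (rule mean_ent_bf_noise) (use p q in auto)
  also have "(\<Sum>t\<in>set_pmf ?T. pmf ?T t * ent (bits n) (pmf (?Y t))) =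
      real n * (q1 * bin_entropy p1 + (1 - q1) * bin_entropy p2)"
    unfolding sum_states_fst[of B q1 q1s "\<lambda>s. ent (bits n) (pmf (bf_noise p1 p2 N B s))"]
    unfolding n_def by (rule mean_ent_bf_noise) (use p q in auto)
  finally show ?thesis unfolding n_def by (simp only: right_diff_distrib distrib_left)
qed

lemma converse:
  assumes q: "0 \<le> q1" "q1 \<le> 1" "0 \<le> q1s" "q1s \<le> 1"
    and p: "0 \<le> p1" "p1 \<le> p2" "p2 \<le> p1s" "p1s \<le> p2s" "p2s \<le> 1/2"
    and R: "achievable_csid q1 q1s p1 p2 p1s p2s R"
  shows "R \<le> q1s * bin_entropy p1s + (1 - q1s) * bin_entropy p2s
       - q1 * bin_entropy p1 - (1 - q1) * bin_entropy p2" (is "R \<le> ?C")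
proof (rule field_le_epsilon)
  fix e :: real assume e: "e > 0"
  obtain N B M f g where M: "\<forall>n. M n \<ge> 1"
    and f: "\<forall>n m x. m < M n \<longrightarrow> x \<in> set_pmf (f n m) \<longrightarrow> length x = N n * B n"
    and N: "filterlim N at_top sequentially" and B: "filterlim B at_top sequentially"
    and rate: "\<forall>\<epsilon>>0. eventually (\<lambda>n. log 2 (real (M n)) / real (N n * B n) \<ge> R - \<epsilon>) sequentially"
    and err: "(\<lambda>n. wt_err q1 q1s p1 p2 p1s p2s (N n) (B n) (M n) (f n) (g n)) \<longlonglongrightarrow> 0"
    and leak: "(\<lambda>n. wt_leak q1 q1s p1 p2 p1s p2s (N n) (B n) (M n) (f n) / real (N n * B n)) \<longlonglongrightarrow> 0"
    using R unfolding achievable_csid_def by (elim exE conjE) (rule that)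
  define k where "k = (\<lambda>n. real (N n * B n))"
  define P L l where "P = (\<lambda>n. wt_err q1 q1s p1 p2 p1s p2s (N n) (B n) (M n) (f n) (g n))"
    and "L = (\<lambda>n. wt_leak q1 q1s p1 p2 p1s p2s (N n) (B n) (M n) (f n) / k n)"
    and "l = (\<lambda>n. log 2 (real (M n)) / k n)"
  have k: "filterlim k at_top sequentially"
    unfolding k_def of_nat_mult
    by (intro filterlim_at_top_mult_at_top filterlim_compose[OF filterlim_real_sequentially] N B)
  define C where "C = ?C"
  have bound: "(1 - P n) * l n \<le> L n + 1 / k n + C" if "k n > 0" for n
  proof -
    have "set_pmf (f n m) \<subseteq> bits (N n * B n)" if "m < M n" for m
      using f that by auto
    then have "(1 - P n) * log 2 (M n) - 1 \<le> wt_leak q1 q1s p1 p2 p1s p2s (N n) (B n) (M n) (f n) + k n * C"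
      unfolding P_def k_def C_def by (intro converse_bound[OF q p M[rule_format]])
    moreover have "wt_leak q1 q1s p1 p2 p1s p2s (N n) (B n) (M n) (f n) = L n * k n"
      using that unfolding L_def by simp
    moreover have "log 2 (M n) = l n * k n"
      using that unfolding l_def by simp
    ultimately have "(1 - P n) * l n * k n - 1 \<le> L n * k n + C * k n"
      by (simp add: mult_ac)
    then have "((1 - P n) * l n * k n - 1) / k n \<le> (L n * k n + C * k n) / k n"
      using that by (intro divide_right_mono) auto
    then show ?thesis
      using that by (simp add: add_divide_distrib diff_divide_distrib)
  qed
  have P1: "P n \<le> 1" for n unfolding P_def wt_err_def by simp
  have "eventually (\<lambda>n. R - e \<le> l n) sequentially"
    using rate[rule_format, OF e] unfolding l_def k_def .
  moreover have "eventually (\<lambda>n. 0 < k n) sequentially"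
    using k unfolding filterlim_at_top_dense by blast
  ultimately have "eventually (\<lambda>n. k n > 0 \<and> R - e \<le> l n) sequentially"
    by eventually_elim simp
  \<comment> \<open>Nothing is known about convergence of the rate \<open>l n\<close>, so it is
    replaced by its lower bound \<open>R - e\<close> before passing to the limit; this uses
    \<open>1 - P n \<ge> 0\<close>.\<close>
  then have ev: "eventually (\<lambda>n. (1 - P n) * (R - e) \<le> L n + 1 / k n + C) sequentially"
  proof (rule eventually_mono)
    fix n assume n: "k n > 0 \<and> R - e \<le> l n"
    have "(1 - P n) * (R - e) \<le> (1 - P n) * l n" using n P1[of n] by (intro mult_left_mono) auto
    then show "(1 - P n) * (R - e) \<le> L n + 1 / k n + C" using bound[of n] n by linarith
  qed
  have L: "L \<longlonglongrightarrow> 0" using leak unfolding L_def k_def .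
  have P: "P \<longlonglongrightarrow> 0" using err unfolding P_def .
  have k': "(\<lambda>n. 1 / k n) \<longlonglongrightarrow> 0"
    by (rule tendsto_divide_0[OF tendsto_const filterlim_at_top_imp_at_infinity[OF k]])
  have lim: "(\<lambda>n. L n + 1 / k n + C) \<longlonglongrightarrow> 0 + 0 + C"
    by (intro tendsto_add tendsto_const L k')
  have lim': "(\<lambda>n. (1 - P n) * (R - e)) \<longlonglongrightarrow> (1 - 0) * (R - e)"
    by (intro tendsto_mult tendsto_diff tendsto_const P)
  have "(1 - 0) * (R - e) \<le> 0 + 0 + C"
    by (rule tendsto_le[OF sequentially_bot lim lim' ev])
  then show "R \<le> ?C + e" by (simp add: C_def)
qed

section \<open>Random coding\<close>

lemma exists_le_average:
  fixes F :: "'a \<Rightarrow> real" and r :: real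
  assumes "finite A" "A \<noteq> {}" "sum F A \<le> card A * r"
  shows "\<exists>x\<in>A. F x \<le> r"
proof (rule ccontr)
  assume "\<not> (\<exists>x\<in>A. F x \<le> r)"
  then have "(\<Sum>x\<in>A. r) < sum F A" using assms by (intro sum_strict_mono) auto
  then show False using assms(3) by simp
qed

text \<open>Pairwise independence in counting form: with all codewords but \<open>c i\<close> fixed,
  \<open>c i\<close> runs through all strings, hence so does its sum with
  \<open>c j\<close>.\<close>

lemma sum_codebooks:
  fixes F :: "bool list \<Rightarrow> real"
  assumes "finite I" "i \<in> I" "j \<in> I" "i \<noteq> j"
  shows "(\<Sum>c\<in>PiE I (\<lambda>_. bits n). F (bxor (c i) (c j))) =
    card (PiE I (\<lambda>_. bits n)) / 2 ^ n * (\<Sum>w\<in>bits n. F w)"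
proof -
  let ?C = "\<lambda>J. PiE J (\<lambda>_. bits n)"
  define J where "J = I - {i}"
  have I: "I = insert i J" and J: "i \<notin> J" "finite J" "j \<in> J" using assms by (auto simp: J_def)
  have card: "real (card (?C I)) = 2 ^ n * card (?C J)"
    using J by (simp add: I card_PiE card_bits)
  have "(\<Sum>c\<in>?C I. F (bxor (c i) (c j))) = (\<Sum>(a, c)\<in>bits n \<times> ?C J. F (bxor a (c j)))"
    unfolding I PiE_insert_eq using J
    by (subst sum.reindex[OF inj_combinator]) (auto simp: case_prod_unfold intro!: sum.cong)
  also have "\<dots> = (\<Sum>c\<in>?C J. \<Sum>a\<in>bits n. F (bxor (c j) a))"
    by (simp add: sum.swap[of _ "bits n"] bxor_commute flip: sum.cartesian_product)
  also have "\<dots> = (\<Sum>c\<in>?C J. \<Sum>w\<in>bits n. F w)"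
  proof (rule sum.cong)
    fix c assume "c \<in> ?C J"
    then have "length (c j) = n" using PiE_mem[of c J "\<lambda>_. bits n" j] J(3) by simp
    then show "(\<Sum>a\<in>bits n. F (bxor (c j) a)) = (\<Sum>w\<in>bits n. F w)" by (rule sum_bits_bxor)
  qed simp
  finally show ?thesis by (simp add: card)
qed

lemma prob_eq_sum_bits:
  assumes "set_pmf W \<subseteq> bits n"
  shows "measure_pmf.prob W A = (\<Sum>e\<in>bits n. pmf W e * of_bool (e \<in> A))"
proof -
  have "measure_pmf.prob W A = measure_pmf.prob W (bits n \<inter> A)"
    using assms by (intro measure_prob_cong_0) (auto simp: pmf_eq_0_set_pmf)
  also have "\<dots> = (\<Sum>e\<in>bits n \<inter> A. pmf W e)" by (intro measure_measure_pmf_finite) simp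
  also have "\<dots> = (\<Sum>e\<in>bits n. pmf W e * of_bool (e \<in> A))"
    by (simp add: sum.inter_restrict of_bool_def if_distrib cong: if_cong)
  finally show ?thesis .
qed

text \<open>A codebook maps a pair of a message and a randomization index to a codeword. The decoder's
  \<open>SOME\<close> is an arbitrary number when no message passes the threshold.\<close>

definition code_enc :: "nat \<Rightarrow> (nat \<times> nat \<Rightarrow> bool list) \<Rightarrow> nat \<Rightarrow> bool list pmf" where
  "code_enc K c m = map_pmf (\<lambda>k. c (m, k)) (pmf_of_set {..<K})"

definition code_dec :: "nat \<Rightarrow> nat \<Rightarrow> (nat \<times> nat \<Rightarrow> bool list) \<Rightarrow> real \<Rightarrow> bool list pmf \<Rightarrow> bool list \<Rightarrow> nat" where
  "code_dec M K c \<theta> W y = (SOME m. m < M \<and> (\<exists>k<K. \<theta> \<le> pmf W (bxor (c (m, k)) y)))"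

lemma noisy_code_enc:
  "noisy W (code_enc K c m) = bind_pmf (pmf_of_set {..<K}) (\<lambda>k. map_pmf (bxor (c (m, k))) W)"
  by (simp add: noisy_def code_enc_def bind_map_pmf)

lemma prob_noisy_code_enc:
  assumes "K \<ge> 1"
  shows "measure_pmf.prob (noisy W (code_enc K c m)) A =
    (\<Sum>k<K. measure_pmf.prob W {e. bxor (c (m, k)) e \<in> A}) / K"
proof -
  have ne: "{..<K} \<noteq> {}" using assms by (auto simp: lessThan_empty_iff)
  have "measure_pmf.prob (noisy W (code_enc K c m)) A = pmf (map_pmf (\<lambda>y. y \<in> A) (noisy W (code_enc K c m))) True"
    by (simp add: pmf_map vimage_def)
  also have "\<dots> = (\<Sum>k<K. measure_pmf.prob W {e. bxor (c (m, k)) e \<in> A}) / K"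
    using ne by (simp add: noisy_code_enc map_bind_pmf pmf.map_comp pmf_bind_finite[of _ "{..<K}"]
        pmf_map vimage_def sum_divide_distrib)
  finally show ?thesis .
qed

text \<open>Decoding can fail only if the true noise misses the threshold or another codeword passes
  it. Since at most \<open>1 / \<theta>\<close> strings have probability at least
  \<open>\<theta>\<close>, an independent uniform shift passes with probability at most
  \<open>1 / (\<theta> * 2 ^ n)\<close>. The other codewords of the sent message are counted as
  competitors too, hence \<open>M * K\<close>.\<close>

lemma sum_err_codebooks:
  fixes M K :: nat
  assumes W: "set_pmf W \<subseteq> bits n" and M: "M \<ge> 1" and K: "K \<ge> 1" and \<theta>: "\<theta> > 0"
    and C: "C = PiE ({..<M} \<times> {..<K}) (\<lambda>_. bits n)"
  shows "(\<Sum>c\<in>C. (\<Sum>m<M. measure_pmf.prob (noisy W (code_enc K c m)) {y. code_dec M K c \<theta> W y \<noteq> m}) / M)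
    \<le> card C * (measure_pmf.prob W {e. pmf W e < \<theta>} + real M * real K / (\<theta> * 2 ^ n))"
proof -
  let ?I = "{..<M} \<times> {..<K}"
  let ?a = "measure_pmf.prob W {e. pmf W e < \<theta>}"
  \<comment> \<open>The probability that a competitor at offset \<open>w\<close> from the sent
    codeword passes the threshold.\<close>
  define G where "G = (\<lambda>w. \<Sum>e\<in>bits n. pmf W e * of_bool (\<theta> \<le> pmf W (bxor w e)))"
  have M0: "real M > 0" and K0: "real K > 0" using M K by auto
  have one: "(\<Sum>e\<in>bits n. pmf W e) = 1" using W by (intro sum_pmf_eq_1) auto
  have sumG: "(\<Sum>w\<in>bits n. G w) \<le> 1 / \<theta>"
  proof -
    have "(\<Sum>w\<in>bits n. G w) = (\<Sum>e\<in>bits n. pmf W e * (\<Sum>w\<in>bits n. of_bool (\<theta> \<le> pmf W (bxor e w))))"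
      unfolding G_def by (subst sum.swap) (simp only: sum_distrib_left bxor_commute)
    also have "\<dots> = (\<Sum>e\<in>bits n. pmf W e * (\<Sum>w\<in>bits n. of_bool (\<theta> \<le> pmf W w)))"
      by (intro sum.cong refl arg_cong2[where f = "(*)"] sum_bits_bxor) simp
    also have "\<dots> = (\<Sum>w\<in>bits n. of_bool (\<theta> \<le> pmf W w))"
      by (simp only: one mult_1 flip: sum_distrib_right)
    \<comment> \<open>Markov's inequality for counting: a string with
      \<open>\<theta> \<le> pmf W w\<close> contributes 1, which is at most
      \<open>pmf W w / \<theta>\<close>.\<close>
    also have "\<dots> \<le> (\<Sum>w\<in>bits n. pmf W w / \<theta>)" using \<theta> by (intro sum_mono) auto
    also have "\<dots> = 1 / \<theta>" by (simp only: one flip: sum_divide_distrib)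
    finally show ?thesis .
  qed
  have point: "measure_pmf.prob W {e. code_dec M K c \<theta> W (bxor (c (m, k)) e) \<noteq> m}
      \<le> ?a + (\<Sum>i\<in>?I - {(m, k)}. G (bxor (c i) (c (m, k))))"
    if c: "c \<in> C" and m: "m < M" and k: "k < K" for c m k
  proof -
    have len: "length (c i) = n" if "i \<in> ?I" for i
      using PiE_mem[OF c[unfolded C] that] by simp
    have "of_bool (code_dec M K c \<theta> W (bxor (c (m, k)) e) \<noteq> m) \<le> (of_bool (pmf W e < \<theta>) :: real)
       + (\<Sum>i\<in>?I - {(m, k)}. of_bool (\<theta> \<le> pmf W (bxor (bxor (c i) (c (m, k))) e)))"
      (is "_ \<le> _ + sum ?b _") if e: "length e = n" for e
    proof (cases "pmf W e < \<theta> \<or> (\<exists>i\<in>?I - {(m, k)}. ?b i = 1)")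
      case True
      moreover have "1 \<le> sum ?b (?I - {(m, k)})" if "i \<in> ?I - {(m, k)}" "?b i = 1" for i
        using that member_le_sum[of i "?I - {(m, k)}" ?b] by auto
      moreover have "0 \<le> sum ?b (?I - {(m, k)})" by (intro sum_nonneg) auto
      ultimately have "pmf W e < \<theta> \<and> 0 \<le> sum ?b (?I - {(m, k)}) \<or> 1 \<le> sum ?b (?I - {(m, k)})"
        by blast
      then show ?thesis by (auto simp: of_bool_def simp del: sum.insert)
    next
      case False
      have "code_dec M K c \<theta> W (bxor (c (m, k)) e) = m"
        unfolding code_dec_def
      proof (rule some_equality)
        show "m < M \<and> (\<exists>k'<K. \<theta> \<le> pmf W (bxor (c (m, k')) (bxor (c (m, k)) e)))"
          using m k False e len[of "(m, k)"] by (intro conjI exI[of _ k]) auto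
      next
        fix m' assume "m' < M \<and> (\<exists>k'<K. \<theta> \<le> pmf W (bxor (c (m', k')) (bxor (c (m, k)) e)))"
        then obtain k' where "m' < M" "k' < K" "\<theta> \<le> pmf W (bxor (bxor (c (m', k')) (c (m, k))) e)"
          by (auto simp: bxor_assoc)
        then have "\<not> (m', k') \<in> ?I - {(m, k)}" using False by auto
        then show "m' = m" using \<open>m' < M\<close> \<open>k' < K\<close> by auto
      qed
      then show ?thesis by (simp add: sum_nonneg)
    qed
    then have "measure_pmf.prob W {e. code_dec M K c \<theta> W (bxor (c (m, k)) e) \<noteq> m}
       \<le> (\<Sum>e\<in>bits n. pmf W e * (of_bool (pmf W e < \<theta>)
          + (\<Sum>i\<in>?I - {(m, k)}. of_bool (\<theta> \<le> pmf W (bxor (bxor (c i) (c (m, k))) e)))))"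
      unfolding prob_eq_sum_bits[OF W] by (intro sum_mono mult_left_mono) auto
    also have "\<dots> = ?a + (\<Sum>i\<in>?I - {(m, k)}. G (bxor (c i) (c (m, k))))"
      unfolding prob_eq_sum_bits[OF W] G_def by (subst sum.swap) (simp add: distrib_left sum.distrib sum_distrib_left mult.commute)
    finally show ?thesis .
  qed
  have pair: "(\<Sum>c\<in>C. measure_pmf.prob W {e. code_dec M K c \<theta> W (bxor (c (m, k)) e) \<noteq> m})
      \<le> card C * (?a + real M * real K / (\<theta> * 2 ^ n))" if m: "m < M" and k: "k < K" for m k
  proof -
    have "(\<Sum>c\<in>C. measure_pmf.prob W {e. code_dec M K c \<theta> W (bxor (c (m, k)) e) \<noteq> m})
        \<le> (\<Sum>c\<in>C. ?a + (\<Sum>i\<in>?I - {(m, k)}. G (bxor (c i) (c (m, k)))))"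
      using m k by (intro sum_mono point)
    also have "\<dots> = card C * ?a + (\<Sum>i\<in>?I - {(m, k)}. \<Sum>c\<in>C. G (bxor (c i) (c (m, k))))"
      unfolding sum.distrib by (subst sum.swap) simp
    also have "\<dots> = card C * ?a + (\<Sum>i\<in>?I - {(m, k)}. card C / 2 ^ n * (\<Sum>w\<in>bits n. G w))"
      unfolding C using m k by (intro arg_cong2[where f = "(+)"] sum.cong refl sum_codebooks) auto
    also have "\<dots> \<le> card C * ?a + (\<Sum>i\<in>?I. card C / 2 ^ n * (1 / \<theta>))"
    proof (intro add_left_mono)
      have "(\<Sum>i\<in>?I - {(m, k)}. card C / 2 ^ n * (\<Sum>w\<in>bits n. G w)) \<le> (\<Sum>i\<in>?I - {(m, k)}. card C / 2 ^ n * (1 / \<theta>))"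
        by (intro sum_mono mult_left_mono sumG) auto
      also have "\<dots> \<le> (\<Sum>i\<in>?I. card C / 2 ^ n * (1 / \<theta>))"
        using \<theta> by (intro sum_mono2) auto
      finally show "(\<Sum>i\<in>?I - {(m, k)}. card C / 2 ^ n * (\<Sum>w\<in>bits n. G w)) \<le> (\<Sum>i\<in>?I. card C / 2 ^ n * (1 / \<theta>))" .
    qed
    also have "\<dots> = card C * (?a + real M * real K / (\<theta> * 2 ^ n))"
      by (simp add: card_cartesian_product field_simps)
    finally show ?thesis .
  qed
  have "(\<Sum>c\<in>C. (\<Sum>m<M. measure_pmf.prob (noisy W (code_enc K c m)) {y. code_dec M K c \<theta> W y \<noteq> m}) / M)
    = (\<Sum>m<M. \<Sum>k<K. (\<Sum>c\<in>C. measure_pmf.prob W {e. code_dec M K c \<theta> W (bxor (c (m, k)) e) \<noteq> m})) / (real M * real K)"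
    unfolding prob_noisy_code_enc[OF K] sum_divide_distrib
    by (subst sum.swap, rule sum.cong[OF refl], subst sum.swap) (simp add: mult.commute)
  also have "\<dots> \<le> (\<Sum>m<M. \<Sum>k<K. card C * (?a + real M * real K / (\<theta> * 2 ^ n))) / (real M * real K)"
    by (intro divide_right_mono sum_mono pair) auto
  also have "\<dots> = card C * (?a + real M * real K / (\<theta> * 2 ^ n))" using M0 K0 by simp
  finally show ?thesis .
qed

lemma log_le_tangent:
  assumes "x > 0" "a > 0"
  shows "log 2 x \<le> log 2 a + (x - a) / (a * ln 2)"
proof -
  have "ln (x / a) \<le> x / a - 1" using assms by (intro ln_le_minus_one) simp
  then have "(ln x - ln a) / ln 2 \<le> (x / a - 1) / ln 2"
    using assms by (intro divide_right_mono) (auto simp: ln_div)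
  then show ?thesis using assms by (simp add: log_def diff_divide_distrib)
qed

text \<open>The output entropy is at most \<open>n\<close>, so the output law may be replaced by the
  uniform one. That reference does not depend on the codebook, and each message can be treated on
  its own.\<close>

lemma mutual_inf_le_uniform:
  fixes M :: nat
  assumes "M \<ge> 1" "\<And>m. m < M \<Longrightarrow> set_pmf (V m) \<subseteq> bits n"
  shows "mutual_inf (bits n) (pmf_of_set {..<M}) V \<le>
    (\<Sum>m<M. \<Sum>z\<in>bits n. pmf (V m) z * log 2 (2 ^ n * pmf (V m) z)) / M"
proof -
  have ne: "{..<M} \<noteq> {}" using assms by (auto simp: lessThan_empty_iff)
  have M0: "real M > 0" using assms by simp
  have *: "(\<Sum>z\<in>bits n. pmf (V m) z * log 2 (2 ^ n * pmf (V m) z)) = n - ent (bits n) (pmf (V m))" if "m < M" for m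
  proof -
    have "(\<Sum>z\<in>bits n. pmf (V m) z * log 2 (2 ^ n * pmf (V m) z)) =
      (\<Sum>z\<in>bits n. pmf (V m) z * n + pmf (V m) z * log 2 (pmf (V m) z))"
    proof (rule sum.cong)
      fix z
      show "pmf (V m) z * log 2 (2 ^ n * pmf (V m) z) = pmf (V m) z * n + pmf (V m) z * log 2 (pmf (V m) z)"
      proof (cases "pmf (V m) z = 0")
        case False
        then have "pmf (V m) z > 0" by (simp add: pmf_positive)
        then show ?thesis by (simp add: log_mult_pos log_nat_power distrib_left)
      qed simp
    qed simp
    also have "\<dots> = n - ent (bits n) (pmf (V m))"
      using assms(2)[OF that] by (simp add: sum.distrib ent_def sum_pmf_eq_1 flip: sum_distrib_right)
    finally show ?thesis .
  qed
  have "set_pmf (bind_pmf (pmf_of_set {..<M}) V) \<subseteq> bits n" using assms ne by auto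
  then have "mutual_inf (bits n) (pmf_of_set {..<M}) V \<le> n - (\<Sum>m<M. ent (bits n) (pmf (V m))) / M"
    using ent_bits_le[of "bind_pmf (pmf_of_set {..<M}) V" n] ne by (simp add: mutual_inf_eq_ent sum_divide_distrib)
  also have "\<dots> = (\<Sum>m<M. n - ent (bits n) (pmf (V m))) / M"
    using M0 by (simp add: sum_subtractf diff_divide_distrib)
  finally show ?thesis using * by (simp cong: sum.cong_simp)
qed

lemma pmf_noisy_code_enc:
  fixes K :: nat
  assumes "set_pmf W \<subseteq> bits n" "K \<ge> 1" "\<And>k. k < K \<Longrightarrow> length (c (m, k)) = n" "length z = n"
  shows "pmf (noisy W (code_enc K c m)) z = (\<Sum>k<K. pmf W (bxor (c (m, k)) z)) / K"
proof -
  have ne: "{..<K} \<noteq> {}" using assms by (auto simp: lessThan_empty_iff)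
  show ?thesis unfolding noisy_code_enc using ne assms
    by (simp add: pmf_bind_finite[of _ "{..<K}"] pmf_map_bxor sum_divide_distrib)
qed

text \<open>A soft covering (resolvability) bound. Inside the logarithm,
  \<open>2 ^ n * pmf W e / K\<close> is the share of the transmitted codeword itself, and 1 bounds
  the mean share of the \<open>K - 1\<close> others, each of which averages to the uniform
  law.\<close>

lemma sum_leak_codebooks:
  fixes M K :: nat
  assumes W: "set_pmf W \<subseteq> bits n" and M: "M \<ge> 1" and K: "K \<ge> 1"
    and C: "C = PiE ({..<M} \<times> {..<K}) (\<lambda>_. bits n)"
  shows "(\<Sum>c\<in>C. mutual_inf (bits n) (pmf_of_set {..<M}) (\<lambda>m. noisy W (code_enc K c m)))
    \<le> card C * (\<Sum>e\<in>bits n. pmf W e * log 2 (1 + 2 ^ n * pmf W e / K))"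
proof -
  let ?I = "{..<M} \<times> {..<K}"
  have M0: "real M > 0" and K0: "real K > 0" using M K by auto
  have neK: "{..<K} \<noteq> {}" using K by (auto simp: lessThan_empty_iff)
  have one: "(\<Sum>e\<in>bits n. pmf W e) = 1" using W by (intro sum_pmf_eq_1) auto
  have len: "length (c i) = n" if "c \<in> C" "i \<in> ?I" for c i
    using PiE_mem[OF that(1)[unfolded C] that(2)] by simp
  \<comment> \<open>\<open>X c m k e\<close> is the output probability under message \<open>m\<close>, relative to the uniform one, at the
      noisy codeword \<open>c (m, k) + e\<close>; its codebook mean is at most \<open>a e\<close>, and the tangent of
      the logarithm at \<open>a e\<close> gives Jensen's inequality.\<close>
  define X where "X = (\<lambda>(c :: nat \<times> nat \<Rightarrow> bool list) m k e. 2 ^ n / K * (\<Sum>j<K. pmf W (bxor (bxor (c (m, j)) (c (m, k))) e)))"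
  define a where "a = (\<lambda>e. 1 + 2 ^ n * pmf W e / K)"
  have a: "a e > 0" for e using K0 by (simp add: a_def add_pos_nonneg)
  have meanX: "(\<Sum>c\<in>C. X c m k e) \<le> card C * a e" if m: "m < M" and k: "k < K" and e: "length e = n" for m k e
  proof -
    have W1: "(\<Sum>w\<in>bits n. pmf W (bxor w e)) = 1"
      using sum_bits_bxor[of e n "pmf W"] e one by (simp add: bxor_commute[of _ e])
    have inner: "(\<Sum>c\<in>C. pmf W (bxor (bxor (c (m, j)) (c (m, k))) e)) = 
      (if j = k then card C * pmf W e else card C / 2 ^ n)" if j: "j < K" for j
    proof (cases "j = k")
      case True
      have "bxor (bxor (c (m, k)) (c (m, k))) e = e" if "c \<in> C" for c
        using len[OF that, of "(m, k)"] m k e by (simp add: bxor_assoc)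
      then show ?thesis using True by simp
    next
      case False
      then show ?thesis
        using sum_codebooks[of ?I "(m, j)" "(m, k)" "\<lambda>w. pmf W (bxor w e)" n] m k j W1 by (simp add: C)
    qed
    have "(\<Sum>c\<in>C. X c m k e) = 2 ^ n / K * (\<Sum>j<K. \<Sum>c\<in>C. pmf W (bxor (bxor (c (m, j)) (c (m, k))) e))"
      unfolding X_def sum_distrib_left[symmetric] by (subst sum.swap) simp
    also have "\<dots> = 2 ^ n / K * (\<Sum>j<K. (if j = k then card C * pmf W e else card C / 2 ^ n))"
      by (simp add: inner)
    \<comment> \<open>The index \<open>j = k\<close> is given the uniform share as well, so that
      \<open>K - 1\<close> is rounded up to \<open>K\<close>.\<close>
    also have "\<dots> \<le> 2 ^ n / K * (\<Sum>j<K. (if j = k then card C * pmf W e else 0) + card C / 2 ^ n)"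
      by (intro mult_left_mono sum_mono) auto
    also have "\<dots> = card C * a e" using k K0 by (simp add: sum.distrib a_def) (simp add: field_simps)
    finally show ?thesis .
  qed
  have point: "(\<Sum>c\<in>C. pmf W e * log 2 (X c m k e)) \<le> card C * (pmf W e * log 2 (a e))"
    if m: "m < M" and k: "k < K" and e: "length e = n" for m k e
  proof (cases "pmf W e = 0")
    case False
    then have We: "pmf W e > 0" by (simp add: pmf_positive)
    have "X c m k e > 0" if c: "c \<in> C" for c
    proof -
      have "bxor (bxor (c (m, k)) (c (m, k))) e = e"
        using len[OF c, of "(m, k)"] m k e by (simp add: bxor_assoc)
      then have "(\<Sum>j<K. pmf W (bxor (bxor (c (m, j)) (c (m, k))) e)) > 0"
        using k We by (intro sum_pos2[of _ k]) auto
      then show ?thesis using K0 by (simp add: X_def)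
    qed
    then have "(\<Sum>c\<in>C. log 2 (X c m k e)) \<le> (\<Sum>c\<in>C. log 2 (a e) + (X c m k e - a e) / (a e * ln 2))"
      by (intro sum_mono log_le_tangent a)
    also have "\<dots> = card C * log 2 (a e) + ((\<Sum>c\<in>C. X c m k e) - card C * a e) / (a e * ln 2)"
      by (simp add: sum.distrib sum_subtractf flip: sum_divide_distrib)
    also have "\<dots> \<le> card C * log 2 (a e)"
    proof -
      have "((\<Sum>c\<in>C. X c m k e) - card C * a e) / (a e * ln 2) \<le> 0"
        using meanX[OF m k e] a[of e] by (intro divide_nonpos_pos) auto
      then show ?thesis by simp
    qed
    finally show ?thesis using We by (simp add: mult.left_commute flip: sum_distrib_left)
  qed simp
  have leak: "mutual_inf (bits n) (pmf_of_set {..<M}) (\<lambda>m. noisy W (code_enc K c m))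
     \<le> (\<Sum>m<M. \<Sum>k<K. \<Sum>e\<in>bits n. pmf W e * log 2 (X c m k e)) / (real M * real K)" if c: "c \<in> C" for c
  proof -
    have enc: "set_pmf (noisy W (code_enc K c m)) \<subseteq> bits n" if "m < M" for m
      using that neK len[OF c] by (intro set_noisy W) (auto simp: code_enc_def)
    have V: "pmf (noisy W (code_enc K c m)) z = (\<Sum>k<K. pmf W (bxor (c (m, k)) z)) / K"
      if "m < M" "length z = n" for m z
      by (rule pmf_noisy_code_enc[OF W K]) (use that len[OF c] in auto)
    have "(\<Sum>z\<in>bits n. pmf (noisy W (code_enc K c m)) z * log 2 (2 ^ n * pmf (noisy W (code_enc K c m)) z))
       = (\<Sum>k<K. \<Sum>e\<in>bits n. pmf W e * log 2 (X c m k e)) / K" if m: "m < M" for m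
    proof -
      let ?L = "\<lambda>z. log 2 (2 ^ n * pmf (noisy W (code_enc K c m)) z)"
      have "(\<Sum>z\<in>bits n. pmf (noisy W (code_enc K c m)) z * ?L z) =
         (\<Sum>z\<in>bits n. (\<Sum>k<K. pmf W (bxor (c (m, k)) z) * ?L z) / K)"
        using m by (intro sum.cong) (auto simp: V sum_distrib_right)
      also have "\<dots> = (\<Sum>k<K. \<Sum>z\<in>bits n. pmf W (bxor (c (m, k)) z) * ?L z) / K"
        unfolding sum_divide_distrib by (rule sum.swap)
      finally have eq: "(\<Sum>z\<in>bits n. pmf (noisy W (code_enc K c m)) z * ?L z) =
          (\<Sum>k<K. \<Sum>z\<in>bits n. pmf W (bxor (c (m, k)) z) * ?L z) / K" .
      \<comment> \<open>Substitution \<open>z = bxor (c (m, k)) e\<close>: the output is re-indexed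
        by the noise, whose weight \<open>pmf W e\<close> does not depend on the codebook.\<close>
      have shift: "(\<Sum>z\<in>bits n. pmf W (bxor (c (m, k)) z) * ?L z) = (\<Sum>e\<in>bits n. pmf W e * log 2 (X c m k e))"
        if k: "k < K" for k
      proof -
        have lk: "length (c (m, k)) = n" using m k len[OF c] by auto
        have "(\<Sum>z\<in>bits n. pmf W (bxor (c (m, k)) z) * ?L z) =
           (\<Sum>e\<in>bits n. pmf W (bxor (c (m, k)) (bxor (c (m, k)) e)) * ?L (bxor (c (m, k)) e))"
          using sum_bits_bxor[OF lk, of "\<lambda>z. pmf W (bxor (c (m, k)) z) * ?L z"] by simp
        also have "\<dots> = (\<Sum>e\<in>bits n. pmf W e * log 2 (X c m k e))"
          using lk m by (intro sum.cong) (auto simp: V X_def bxor_assoc)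
        finally show ?thesis .
      qed
      have "(\<Sum>k<K. \<Sum>z\<in>bits n. pmf W (bxor (c (m, k)) z) * ?L z) =
          (\<Sum>k<K. \<Sum>e\<in>bits n. pmf W e * log 2 (X c m k e))"
        by (intro sum.cong refl shift) auto
      with eq show ?thesis by simp
    qed
    then show ?thesis
      using mutual_inf_le_uniform[OF M enc] by (simp add: sum_divide_distrib mult.commute)
  qed
  have "(\<Sum>c\<in>C. mutual_inf (bits n) (pmf_of_set {..<M}) (\<lambda>m. noisy W (code_enc K c m)))
     \<le> (\<Sum>c\<in>C. (\<Sum>m<M. \<Sum>k<K. \<Sum>e\<in>bits n. pmf W e * log 2 (X c m k e)) / (real M * real K))"
    by (intro sum_mono leak)
  also have "\<dots> = (\<Sum>m<M. \<Sum>k<K. \<Sum>e\<in>bits n. \<Sum>c\<in>C. pmf W e * log 2 (X c m k e)) / (real M * real K)"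
    unfolding sum_divide_distrib[symmetric] sum.swap[of _ _ C] by (rule refl)
  also have "\<dots> \<le> (\<Sum>m<M. \<Sum>k<K. \<Sum>e\<in>bits n. card C * (pmf W e * log 2 (a e))) / (real M * real K)"
    by (intro divide_right_mono sum_mono point) auto
  also have "\<dots> = card C * (\<Sum>e\<in>bits n. pmf W e * log 2 (a e))"
    using M0 K0 by (simp flip: sum_distrib_left)
  finally show ?thesis by (simp add: a_def)
qed

text \<open>Derandomization. The state average is moved inside the codebook average, and error plus
  \<open>b\<close> times leakage is selected as one quantity, so a single codebook is good on
  average over all states. The decoder gets the realized noise law \<open>Wy t\<close>, which is its
  state information.\<close>

lemma exists_wiretap_code:
  fixes M K :: nat
  assumes T: "finite (set_pmf T)" and Wy: "\<And>t. set_pmf (Wy t) \<subseteq> bits n" and Wz: "\<And>t. set_pmf (Wz t) \<subseteq> bits n"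
    and M: "M \<ge> 1" and K: "K \<ge> 1" and \<theta>: "\<theta> > 0" and b: "b \<ge> 0"
  shows "\<exists>f g. (\<forall>m<M. set_pmf (f m) \<subseteq> bits n) \<and>
    (\<Sum>t\<in>set_pmf T. pmf T t * ((\<Sum>m<M. measure_pmf.prob (noisy (Wy t) (f m)) {y. g y t \<noteq> m}) / M)) +
     b * (\<Sum>t\<in>set_pmf T. pmf T t * mutual_inf (bits n) (pmf_of_set {..<M}) (\<lambda>m. noisy (Wz t) (f m)))
    \<le> (\<Sum>t\<in>set_pmf T. pmf T t * measure_pmf.prob (Wy t) {e. pmf (Wy t) e < \<theta>}) + real M * real K / (\<theta> * 2 ^ n)
      + b * (\<Sum>t\<in>set_pmf T. pmf T t * (\<Sum>e\<in>bits n. pmf (Wz t) e * log 2 (1 + 2 ^ n * pmf (Wz t) e / K)))"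
proof -
  define C where "C = PiE ({..<M} \<times> {..<K}) (\<lambda>_. bits n)"
  define E where "E = (\<lambda>c t. (\<Sum>m<M. measure_pmf.prob (noisy (Wy t) (code_enc K c m)) {y. code_dec M K c \<theta> (Wy t) y \<noteq> m}) / M)"
  define L where "L = (\<lambda>c t. mutual_inf (bits n) (pmf_of_set {..<M}) (\<lambda>m. noisy (Wz t) (code_enc K c m)))"
  define E' where "E' = (\<lambda>t. measure_pmf.prob (Wy t) {e. pmf (Wy t) e < \<theta>} + real M * real K / (\<theta> * 2 ^ n))"
  define L' where "L' = (\<lambda>t. \<Sum>e\<in>bits n. pmf (Wz t) e * log 2 (1 + 2 ^ n * pmf (Wz t) e / K))"
  have one: "(\<Sum>t\<in>set_pmf T. pmf T t) = 1" using T by (intro sum_pmf_eq_1) auto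
  have neK: "{..<K} \<noteq> {}" using K by (auto simp: lessThan_empty_iff)
  have "(\<Sum>c\<in>C. \<Sum>t\<in>set_pmf T. pmf T t * (E c t + b * L c t)) = 
     (\<Sum>t\<in>set_pmf T. pmf T t * ((\<Sum>c\<in>C. E c t) + b * (\<Sum>c\<in>C. L c t)))"
    by (subst sum.swap) (simp add: sum_distrib_left sum.distrib distrib_left)
  also have "\<dots> \<le> (\<Sum>t\<in>set_pmf T. pmf T t * (card C * E' t + b * (card C * L' t)))"
    using b unfolding E_def L_def E'_def L'_def
    by (intro sum_mono mult_left_mono add_mono sum_err_codebooks sum_leak_codebooks Wy Wz M K \<theta> C_def) auto
  also have "\<dots> = card C * (\<Sum>t\<in>set_pmf T. pmf T t * (E' t + b * L' t))"
    by (simp add: sum_distrib_left algebra_simps)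
  finally have "\<exists>c\<in>C. (\<Sum>t\<in>set_pmf T. pmf T t * (E c t + b * L c t)) \<le> (\<Sum>t\<in>set_pmf T. pmf T t * (E' t + b * L' t))"
  proof (rule exists_le_average[rotated 2])
    have "(\<lambda>i\<in>{..<M} \<times> {..<K}. replicate n True) \<in> C" by (auto simp: C_def)
    then show "C \<noteq> {}" by blast
  qed (auto simp: C_def intro: finite_PiE)
  then obtain c where c: "c \<in> C"
    "(\<Sum>t\<in>set_pmf T. pmf T t * (E c t + b * L c t)) \<le> (\<Sum>t\<in>set_pmf T. pmf T t * (E' t + b * L' t))" by blast
  have "(\<Sum>t\<in>set_pmf T. pmf T t * (E' t + b * L' t)) =
     (\<Sum>t\<in>set_pmf T. pmf T t * measure_pmf.prob (Wy t) {e. pmf (Wy t) e < \<theta>}) + real M * real K / (\<theta> * 2 ^ n)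
      + b * (\<Sum>t\<in>set_pmf T. pmf T t * L' t)"
    using one unfolding E'_def distrib_left sum.distrib sum_distrib_right[symmetric] sum_distrib_left mult.left_commute[of b]
    by simp
  moreover have "(\<Sum>t\<in>set_pmf T. pmf T t * (E c t + b * L c t)) = 
     (\<Sum>t\<in>set_pmf T. pmf T t * E c t) + b * (\<Sum>t\<in>set_pmf T. pmf T t * L c t)"
    by (simp add: distrib_left sum.distrib sum_distrib_left mult.left_commute)
  moreover have "\<forall>m<M. set_pmf (code_enc K c m) \<subseteq> bits n"
    using c(1) neK by (auto simp: code_enc_def C_def dest: PiE_mem)
  ultimately show ?thesis using c(2) unfolding E_def L_def L'_def
    by (intro exI[of _ "code_enc K c"] exI[of _ "\<lambda>y t. code_dec M K c \<theta> (Wy t) y"]) simp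
qed

section \<open>Typicality for the block-fading noise\<close>

lemma second_moment_state_sum:
  assumes "0 \<le> q" "q \<le> 1" "q * F True + (1 - q) * F False = 0"
  shows "(\<Sum>s\<in>bits B. pmf (bern_list (replicate B q)) s * (sum_list (map F s))\<^sup>2)
    = real B * (q * (F True)\<^sup>2 + (1 - q) * (F False)\<^sup>2)"
proof -
  have "map2 (\<lambda>_. F) (replicate B q) s = map F s" if "length s = B" for s
    using that by (simp add: zip_replicate1 o_def)
  then have "(\<Sum>s\<in>bits B. pmf (bern_list (replicate B q)) s * (sum_list (map F s))\<^sup>2) =
     (\<Sum>s\<in>bits B. pmf (bern_list (replicate B q)) s * (sum_list (map2 (\<lambda>_. F) (replicate B q) s))\<^sup>2)"
    by (intro sum.cong) auto
  also have "\<dots> = real B * (q * (F True)\<^sup>2 + (1 - q) * (F False)\<^sup>2)"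
    using bern_list_second_moment[of "replicate B q" "\<lambda>_. F"] assms
    by (simp add: sum_list_replicate)
  finally show ?thesis .
qed

lemma sum_list_map2_add:
  fixes f :: "'a \<Rightarrow> 'b \<Rightarrow> real"
  assumes "length xs = length ys"
  shows "sum_list (map2 (\<lambda>x y. f x y + g x) xs ys) = sum_list (map2 f xs ys) + sum_list (map g xs)"
  using assms by (induction xs ys rule: list_induct2) auto

text \<open>The deviation of the log-probability from \<open>- n * h\<close> splits into the symbol
  noise given the states, with variance of order \<open>n\<close>, and the deviation
  \<open>?Y\<close> of the conditional entropy from its mean, with variance of order
  \<open>N^2 * B = n^2 / B\<close>. The constant comes from
  \<open>(x - y)^2 \<le> 2 * x^2 + 2 * y^2\<close>.\<close>

lemma block_fading_second_moment:
  assumes p: "0 \<le> pa" "pa \<le> 1" "0 \<le> pb" "pb \<le> 1" and q: "0 \<le> q" "q \<le> 1"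
    and h: "h = q * bin_entropy pa + (1 - q) * bin_entropy pb"
  shows "\<exists>V\<ge>0. \<forall>N\<ge>1. \<forall>B\<ge>1.
    (\<Sum>s\<in>bits B. pmf (bern_list (replicate B q)) s *
      (\<Sum>e\<in>bits (N * B). pmf (bf_noise pa pb N B s) e * (log 2 (pmf (bf_noise pa pb N B s) e) + real (N * B) * h)\<^sup>2))
    \<le> V * (real (N * B))\<^sup>2 / real B"
proof -
  let ?l = "\<lambda>p b. log 2 (if b then p else 1 - p)"
  define \<phi> where "\<phi> = (\<lambda>p b. ?l p b + bin_entropy p)"
  define \<sigma> where "\<sigma> = (\<lambda>p. p * (\<phi> p True)\<^sup>2 + (1 - p) * (\<phi> p False)\<^sup>2)"
  define F where "F = (\<lambda>b. (if b then bin_entropy pa else bin_entropy pb) - h)"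
  define u where "u = q * (F True)\<^sup>2 + (1 - q) * (F False)\<^sup>2"
  define v where "v = \<sigma> pa + \<sigma> pb"
  have \<sigma>0: "0 \<le> \<sigma> pa" "0 \<le> \<sigma> pb" using p by (auto simp: \<sigma>_def)
  have u0: "0 \<le> u" using q by (simp add: u_def)
  have centred: "p * \<phi> p True + (1 - p) * \<phi> p False = 0" for p
    by (simp add: \<phi>_def bin_entropy_def algebra_simps)
  have Fmean: "q * F True + (1 - q) * F False = 0" by (simp add: F_def h algebra_simps)
  show ?thesis
  proof (intro exI[of _ "2 * v + 2 * u"] conjI allI impI)
    show "0 \<le> 2 * v + 2 * u" using \<sigma>0 u0 by (simp add: v_def)
  next
    fix N B :: nat assume N: "N \<ge> 1" and B: "B \<ge> 1"
    let ?n = "N * B" and ?P = "bern_list (replicate B q)"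
    have each: "(\<Sum>e\<in>bits ?n. pmf (bf_noise pa pb N B s) e * (log 2 (pmf (bf_noise pa pb N B s) e) + real ?n * h)\<^sup>2)
      \<le> 2 * (real ?n * v) + 2 * (real N)\<^sup>2 * (sum_list (map F s))\<^sup>2" if s: "length s = B" for s
    proof -
      define ps where "ps = map (xover pa pb N s) [0..<?n]"
      have ps: "length ps = ?n" by (simp add: ps_def)
      have ps01: "0 \<le> p \<and> p \<le> 1" if "p \<in> set ps" for p
        using that assms(1-4) by (auto simp: ps_def xover_def)
      let ?Y = "real N * sum_list (map F s)"
      have "sum_list (map F s) = sum_list (map (\<lambda>b. if b then bin_entropy pa else bin_entropy pb) s) - real B * h"
        using s by (simp add: F_def sum_list_subtractf sum_list_triv)
      then have Y: "sum_list (map bin_entropy ps) - real ?n * h = ?Y"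
        using sum_list_xover[OF s, of bin_entropy pa pb N] by (simp add: ps_def o_def right_diff_distrib)
      have "sum_list (map \<sigma> ps) = real N * sum_list (map (\<lambda>b. if b then \<sigma> pa else \<sigma> pb) s)"
        using sum_list_xover[OF s, of \<sigma> pa pb N] by (simp add: ps_def o_def)
      also have "\<dots> \<le> real N * sum_list (map (\<lambda>b. v) s)"
        using \<sigma>0 by (intro mult_left_mono sum_list_mono) (auto simp: v_def)
      finally have var: "sum_list (map \<sigma> ps) \<le> real ?n * v"
        using s by (simp add: sum_list_triv mult.assoc)
      have "(\<Sum>e\<in>bits ?n. pmf (bern_list ps) e * (log 2 (pmf (bern_list ps) e) + real ?n * h)\<^sup>2)
        \<le> (\<Sum>e\<in>bits ?n. 2 * (pmf (bern_list ps) e * (sum_list (map2 \<phi> ps e))\<^sup>2) + pmf (bern_list ps) e * (2 * ?Y\<^sup>2))"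
      proof (rule sum_mono)
        fix e assume e: "e \<in> bits ?n"
        show "pmf (bern_list ps) e * (log 2 (pmf (bern_list ps) e) + real ?n * h)\<^sup>2
           \<le> 2 * (pmf (bern_list ps) e * (sum_list (map2 \<phi> ps e))\<^sup>2) + pmf (bern_list ps) e * (2 * ?Y\<^sup>2)"
        proof (cases "pmf (bern_list ps) e = 0")
          case False
          then have "pmf (bern_list ps) e > 0" by (simp add: pmf_positive)
          then have "log 2 (pmf (bern_list ps) e) = sum_list (map2 ?l ps e)"
            using ps01 by (intro log_pmf_bern_list) auto
          moreover have "sum_list (map2 \<phi> ps e) = sum_list (map2 ?l ps e) + sum_list (map bin_entropy ps)"
            unfolding \<phi>_def using ps e by (intro sum_list_map2_add) simp
          ultimately have "log 2 (pmf (bern_list ps) e) + real ?n * h = sum_list (map2 \<phi> ps e) - ?Y"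
            using Y by linarith
          moreover have "(x - y)\<^sup>2 \<le> 2 * x\<^sup>2 + 2 * y\<^sup>2" for x y :: real
            using sum_squares_bound[of x "- y"] by (simp add: power2_diff)
          ultimately have "(log 2 (pmf (bern_list ps) e) + real ?n * h)\<^sup>2 \<le> 2 * (sum_list (map2 \<phi> ps e))\<^sup>2 + 2 * ?Y\<^sup>2"
            by simp
          then have "pmf (bern_list ps) e * (log 2 (pmf (bern_list ps) e) + real ?n * h)\<^sup>2 \<le>
              pmf (bern_list ps) e * (2 * (sum_list (map2 \<phi> ps e))\<^sup>2 + 2 * ?Y\<^sup>2)"
            by (rule mult_left_mono) simp
          then show ?thesis by (simp add: distrib_left mult.left_commute)
        qed simp
      qed
      also have "\<dots> = 2 * sum_list (map \<sigma> ps) + 2 * ?Y\<^sup>2"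
        using bern_list_second_moment[of ps \<phi>] ps01 centred sum_pmf_bern_list[of ps]
        by (simp add: sum.distrib ps \<sigma>_def flip: sum_distrib_left sum_distrib_right)
      also have "\<dots> \<le> 2 * (real ?n * v) + 2 * ?Y\<^sup>2" using var by simp
      finally show ?thesis by (simp add: ps_def bf_noise_def power_mult_distrib mult.assoc)
    qed
    have "(\<Sum>s\<in>bits B. pmf ?P s * (\<Sum>e\<in>bits ?n. pmf (bf_noise pa pb N B s) e * (log 2 (pmf (bf_noise pa pb N B s) e) + real ?n * h)\<^sup>2))
      \<le> (\<Sum>s\<in>bits B. pmf ?P s * (2 * (real ?n * v) + 2 * (real N)\<^sup>2 * (sum_list (map F s))\<^sup>2))"
      by (intro sum_mono mult_left_mono each) auto
    also have "\<dots> = (\<Sum>s\<in>bits B. pmf ?P s) * (2 * (real ?n * v))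
        + 2 * (real N)\<^sup>2 * (\<Sum>s\<in>bits B. pmf ?P s * (sum_list (map F s))\<^sup>2)"
      unfolding sum_distrib_left sum_distrib_right sum.distrib[symmetric]
      by (intro sum.cong) (auto simp: algebra_simps)
    also have "\<dots> = 2 * (real ?n * v) + 2 * (real N)\<^sup>2 * (real B * u)"
      unfolding second_moment_state_sum[OF q Fmean] sum_pmf_bern_list_replicate u_def by simp
    \<comment> \<open>\<open>N \<le> N^2\<close> absorbs the symbol noise into the larger order of
      the state fluctuation.\<close>
    also have "\<dots> \<le> 2 * ((real N)\<^sup>2 * real B * v) + 2 * (real N)\<^sup>2 * (real B * u)"
    proof -
      have "real N * 1 \<le> real N * real N" using N by (intro mult_left_mono) auto
      then have "real ?n * v \<le> (real N)\<^sup>2 * real B * v"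
        using \<sigma>0 by (intro mult_right_mono) (auto simp: v_def power2_eq_square intro: mult_right_mono)
      then show ?thesis by simp
    qed
    also have "\<dots> = (2 * v + 2 * u) * (real ?n)\<^sup>2 / real B"
      using B by (simp add: power2_eq_square field_simps)
    finally show "(\<Sum>s\<in>bits B. pmf ?P s * (\<Sum>e\<in>bits ?n. pmf (bf_noise pa pb N B s) e * (log 2 (pmf (bf_noise pa pb N B s) e) + real ?n * h)\<^sup>2))
      \<le> (2 * v + 2 * u) * (real ?n)\<^sup>2 / real B" .
  qed
qed

text \<open>\<open>W\<close> will be the noise law for the realized states, whereas \<open>h\<close>
  will be the entropy rate averaged over the states: an atypical state sequence counts as a
  deviation too.\<close>

definition atypical :: "real \<Rightarrow> real \<Rightarrow> nat \<Rightarrow> bool list pmf \<Rightarrow> bool list set" where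
  "atypical h \<delta> n W = {e. real n * \<delta> < \<bar>log 2 (pmf W e) + real n * h\<bar>}"

text \<open>Chebyshev's inequality at level \<open>n * \<delta>\<close>: the factor
  \<open>n^2\<close> cancels, leaving a bound in \<open>B\<close> that is uniform in
  \<open>N\<close>.\<close>

lemma block_fading_atypical:
  assumes p: "0 \<le> pa" "pa \<le> 1" "0 \<le> pb" "pb \<le> 1" and q: "0 \<le> q" "q \<le> 1"
    and h: "h = q * bin_entropy pa + (1 - q) * bin_entropy pb" and \<delta>: "\<delta> > 0"
  shows "\<exists>V\<ge>0. \<forall>N\<ge>1. \<forall>B\<ge>1.
    (\<Sum>s\<in>bits B. pmf (bern_list (replicate B q)) s *
      measure_pmf.prob (bf_noise pa pb N B s) (atypical h \<delta> (N * B) (bf_noise pa pb N B s))) \<le> V / real B"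
proof -
  obtain V where V: "V \<ge> 0" and bound: "\<And>N B. N \<ge> 1 \<Longrightarrow> B \<ge> 1 \<Longrightarrow> 
    (\<Sum>s\<in>bits B. pmf (bern_list (replicate B q)) s *
      (\<Sum>e\<in>bits (N * B). pmf (bf_noise pa pb N B s) e * (log 2 (pmf (bf_noise pa pb N B s) e) + real (N * B) * h)\<^sup>2))
    \<le> V * (real (N * B))\<^sup>2 / real B"
    using block_fading_second_moment[OF p q h] by blast
  show ?thesis
  proof (intro exI[of _ "V / \<delta>\<^sup>2"] conjI allI impI)
    show "0 \<le> V / \<delta>\<^sup>2" using V by simp
  next
    fix N B :: nat assume N: "N \<ge> 1" and B: "B \<ge> 1"
    let ?n = "N * B" and ?P = "bern_list (replicate B q)" and ?W = "\<lambda>s. bf_noise pa pb N B s"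
    let ?x = "\<lambda>s e. log 2 (pmf (?W s) e) + real ?n * h"
    define a where "a = real ?n * \<delta>"
    have a: "a > 0" unfolding a_def using N B \<delta> by simp
    have "measure_pmf.prob (?W s) (atypical h \<delta> ?n (?W s)) \<le> (\<Sum>e\<in>bits ?n. pmf (?W s) e * (?x s e)\<^sup>2) / a\<^sup>2" for s
    proof -
      have "of_bool (e \<in> atypical h \<delta> ?n (?W s)) \<le> (?x s e)\<^sup>2 / a\<^sup>2" for e
      proof (cases "e \<in> atypical h \<delta> ?n (?W s)")
        case True
        then have "a \<le> \<bar>?x s e\<bar>" by (simp add: atypical_def a_def)
        then have "a\<^sup>2 \<le> (?x s e)\<^sup>2" using a power_mono[of a "\<bar>?x s e\<bar>" 2] by simp
        then show ?thesis using a True by simp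
      qed simp
      then show ?thesis
        unfolding prob_eq_sum_bits[OF set_bf_noise] sum_divide_distrib times_divide_eq_right[symmetric]
        by (intro sum_mono mult_left_mono) auto
    qed
    then have "(\<Sum>s\<in>bits B. pmf ?P s * measure_pmf.prob (?W s) (atypical h \<delta> ?n (?W s))) \<le>
       (\<Sum>s\<in>bits B. pmf ?P s * ((\<Sum>e\<in>bits ?n. pmf (?W s) e * (?x s e)\<^sup>2) / a\<^sup>2))"
      by (intro sum_mono mult_left_mono) auto
    also have "\<dots> = (\<Sum>s\<in>bits B. pmf ?P s * (\<Sum>e\<in>bits ?n. pmf (?W s) e * (?x s e)\<^sup>2)) / a\<^sup>2"
      by (simp only: times_divide_eq_right sum_divide_distrib[symmetric])
    also have "\<dots> \<le> (V * (real ?n)\<^sup>2 / real B) / a\<^sup>2"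
      by (intro divide_right_mono bound N B) simp
    also have "\<dots> = V / \<delta>\<^sup>2 / real B"
      using N B \<delta> by (simp add: a_def power_mult_distrib)
    finally show "(\<Sum>s\<in>bits B. pmf ?P s * measure_pmf.prob (?W s) (atypical h \<delta> ?n (?W s))) \<le> V / \<delta>\<^sup>2 / real B" .
  qed
qed

text \<open>This is not an inclusion of sets: strings of probability 0 lie on the left but, as
  \<open>log 2 0 = 0\<close>, perhaps not on the right. They carry no weight.\<close>

lemma prob_small_pmf_le_atypical:
  assumes W: "set_pmf W \<subseteq> bits n"
  shows "measure_pmf.prob W {e. pmf W e < 2 powr (- (real n * (h + \<delta>)))} \<le> measure_pmf.prob W (atypical h \<delta> n W)"
  unfolding prob_eq_sum_bits[OF W]
proof (rule sum_mono)
  fix e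
  have "e \<in> atypical h \<delta> n W" if "pmf W e > 0" "pmf W e < 2 powr (- (real n * (h + \<delta>)))"
  proof -
    have "log 2 (pmf W e) < - (real n * (h + \<delta>))" using that by (simp add: log_less_iff)
    then show ?thesis by (simp add: atypical_def distrib_left)
  qed
  then show "pmf W e * of_bool (e \<in> {e. pmf W e < 2 powr (- (real n * (h + \<delta>)))}) \<le> pmf W e * of_bool (e \<in> atypical h \<delta> n W)"
    by (cases "pmf W e = 0") (auto simp: pmf_positive)
qed

text \<open>For typical noise, \<open>2 ^ n * pmf W e\<close> is at most \<open>K\<close> and the
  logarithm at most 1. For atypical noise the crude bounds \<open>pmf W e \<le> 1\<close> and
  \<open>K \<ge> 1\<close> give \<open>n + 1\<close>.\<close>

lemma leak_exponent_le_atypical: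
  assumes W: "set_pmf W \<subseteq> bits n" and K: "K \<ge> (1::nat)" "2 powr (real n * (1 - h + \<delta>)) \<le> K"
  shows "(\<Sum>e\<in>bits n. pmf W e * log 2 (1 + 2 ^ n * pmf W e / K)) \<le> 1 + (real n + 1) * measure_pmf.prob W (atypical h \<delta> n W)"
proof -
  have one: "(\<Sum>e\<in>bits n. pmf W e) = 1" using W by (intro sum_pmf_eq_1) auto
  have K1: "1 \<le> real K" using K by simp
  have "pmf W e * log 2 (1 + 2 ^ n * pmf W e / K) \<le> pmf W e * (1 + (real n + 1) * of_bool (e \<in> atypical h \<delta> n W))" for e
  proof (cases "pmf W e = 0")
    case False
    then have We: "pmf W e > 0" by (simp add: pmf_positive)
    have pos: "1 + 2 ^ n * pmf W e / K > 0" by (intro add_pos_nonneg) auto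
    have "log 2 (1 + 2 ^ n * pmf W e / K) \<le> 1 + (real n + 1) * of_bool (e \<in> atypical h \<delta> n W)"
    proof (cases "e \<in> atypical h \<delta> n W")
      case True
      have "2 ^ n * pmf W e / K \<le> 2 ^ n * 1 / 1" using K1 pmf_le_1 by (intro frac_le mult_left_mono) auto
      then have "1 + 2 ^ n * pmf W e / K \<le> 2 ^ n + 2 ^ n" using one_le_power[of "2::real" n] by linarith
      then have "log 2 (1 + 2 ^ n * pmf W e / K) \<le> log 2 (2 ^ (n + 1))" using pos by simp
      also have "\<dots> = real (n + 1)" by (subst log_nat_power) auto
      finally show ?thesis using True by simp
    next
      case False
      then have "log 2 (pmf W e) \<le> - (real n * (h - \<delta>))" by (simp add: atypical_def algebra_simps)
      then have "pmf W e \<le> 2 powr (- (real n * (h - \<delta>)))" using We by (simp add: log_le_iff)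
      then have "2 ^ n * pmf W e \<le> 2 ^ n * 2 powr (- (real n * (h - \<delta>)))" by simp
      also have "\<dots> = 2 powr (real n * (1 - h + \<delta>))"
        by (simp add: powr_realpow[symmetric] powr_add[symmetric] algebra_simps)
      also have "\<dots> \<le> K" by (rule K)
      finally have "2 ^ n * pmf W e / K \<le> 1" using K1 by simp
      then have "log 2 (1 + 2 ^ n * pmf W e / K) \<le> log 2 2" using pos by (subst log_le_cancel_iff) auto
      then show ?thesis using False by simp
    qed
    then show ?thesis by (intro mult_left_mono) auto
  qed simp
  then have "(\<Sum>e\<in>bits n. pmf W e * log 2 (1 + 2 ^ n * pmf W e / K))
     \<le> (\<Sum>e\<in>bits n. pmf W e * (1 + (real n + 1) * of_bool (e \<in> atypical h \<delta> n W)))"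
    by (intro sum_mono)
  also have "\<dots> = 1 + (real n + 1) * measure_pmf.prob W (atypical h \<delta> n W)"
    unfolding prob_eq_sum_bits[OF W] by (simp only: distrib_left sum.distrib one mult_1_right sum_distrib_left mult.left_commute)
  finally show ?thesis .
qed

lemma bin_entropy_le_1:
  assumes "0 \<le> p" "p \<le> 1"
  shows "bin_entropy p \<le> 1"
proof -
  have "bin_entropy p = ent (bits 1) (pmf (bern_list [p]))"
    using ent_bern_list[of "[p]"] assms by simp
  also have "\<dots> \<le> 1" using ent_bits_le[of "bern_list [p]" 1] set_bern_list[of "[p]"] by simp
  finally show ?thesis .
qed

lemma nat_ceiling_powr_bounds:
  fixes x :: real
  assumes "0 \<le> x"
  shows "1 \<le> nat \<lceil>2 powr x\<rceil>" "2 powr x \<le> real (nat \<lceil>2 powr x\<rceil>)" "real (nat \<lceil>2 powr x\<rceil>) \<le> 2 * 2 powr x"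
proof -
  have one: "1 \<le> 2 powr x" using assms by (simp add: ge_one_powr_ge_zero)
  show "2 powr x \<le> real (nat \<lceil>2 powr x\<rceil>)" by (rule real_nat_ceiling_ge)
  then have "1 \<le> real (nat \<lceil>2 powr x\<rceil>)" using one by linarith
  then show "1 \<le> nat \<lceil>2 powr x\<rceil>" by linarith
  have "real (nat \<lceil>2 powr x\<rceil>) = of_int \<lceil>2 powr x\<rceil>" using one by (intro of_nat_nat) linarith
  then show "real (nat \<lceil>2 powr x\<rceil>) \<le> 2 * 2 powr x" using one by linarith
qed

text \<open>The exponential decay is weakened to \<open>1 / x\<close> because the other error terms
  are only of order \<open>1 / B\<close>.\<close>

lemma powr_minus_le:
  fixes x :: real
  assumes "x > 0"
  shows "2 powr (- x) \<le> 1 / (x * ln 2)"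
proof -
  have "x * ln 2 \<le> exp (x * ln 2)" using exp_ge_add_one_self[of "x * ln 2"] by linarith
  then have "inverse (exp (x * ln 2)) \<le> inverse (x * ln 2)" using assms by (intro le_imp_inverse_le) auto
  then show ?thesis by (simp add: powr_def exp_minus inverse_eq_divide)
qed

section \<open>Achievability\<close>

lemma mutual_inf_nonneg:
  assumes "finite S" "finite (set_pmf P)" "\<And>m. m \<in> set_pmf P \<Longrightarrow> set_pmf (K m) \<subseteq> S"
  shows "0 \<le> mutual_inf S P K"
  unfolding mutual_inf_def
proof (intro sum_nonneg mult_nonneg_nonneg gibbs)
  fix m assume m: "m \<in> set_pmf P"
  have "set_pmf (bind_pmf P K) \<subseteq> S" using assms(3) by auto
  then show "sum (pmf (bind_pmf P K)) S \<le> sum (pmf (K m)) S" using assms m by (simp add: sum_pmf_eq_1)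
qed (auto intro: pmf_bind_pos)

text \<open>Needed because \<open>code_existence\<close> bounds only the sum of error and leakage
  rate.\<close>

lemma wt_leak_nonneg:
  assumes "M \<ge> 1" "\<And>m. m < M \<Longrightarrow> set_pmf (f m) \<subseteq> bits (N * B)"
  shows "0 \<le> wt_leak q1 q1s p1 p2 p1s p2s N B M f"
proof -
  have "{..<M} \<noteq> {}" using assms by (auto simp: lessThan_empty_iff)
  then have "0 \<le> (\<Sum>t\<in>set_pmf (states B q1 q1s). pmf (states B q1 q1s) t *
     mutual_inf (bits (N * B)) (pmf_of_set {..<M}) (\<lambda>m. noisy (bf_noise p1s p2s N B (snd t)) (f m)))"
    using assms set_bf_noise by (intro sum_nonneg mult_nonneg_nonneg mutual_inf_nonneg set_noisy) auto
  then show ?thesis using wt_leak_eq[OF assms(1), of f N B] assms(2) by simp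
qed

text \<open>\<open>D\<close> is uniform in \<open>N\<close> and \<open>B\<close>, so the bound on
  the sum, whose parts are nonnegative, drives both to 0 as \<open>B\<close> grows.\<close>

lemma code_existence:
  assumes q: "0 \<le> q1" "q1 \<le> 1" "0 \<le> q1s" "q1s \<le> 1"
    and p: "0 \<le> p1" "p1 \<le> 1" "0 \<le> p2" "p2 \<le> 1" "0 \<le> p1s" "p1s \<le> 1" "0 \<le> p2s" "p2s \<le> 1"
    and R: "0 \<le> R" "R < q1s * bin_entropy p1s + (1 - q1s) * bin_entropy p2s
       - q1 * bin_entropy p1 - (1 - q1) * bin_entropy p2"
  shows "\<exists>D. \<forall>N\<ge>1. \<forall>B\<ge>1. \<exists>f g.
     (\<forall>m < nat \<lceil>2 powr (real (N * B) * R)\<rceil>. set_pmf (f m) \<subseteq> bits (N * B)) \<and>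
     wt_err q1 q1s p1 p2 p1s p2s N B (nat \<lceil>2 powr (real (N * B) * R)\<rceil>) f g
     + wt_leak q1 q1s p1 p2 p1s p2s N B (nat \<lceil>2 powr (real (N * B) * R)\<rceil>) f / real (N * B) \<le> D / real B"
proof -
  define hy hz where "hy = q1 * bin_entropy p1 + (1 - q1) * bin_entropy p2"
    and "hz = q1s * bin_entropy p1s + (1 - q1s) * bin_entropy p2s"
  \<comment> \<open>One \<open>\<delta>\<close> is spent on the threshold \<open>\<theta>\<close>,
    one on the size of \<open>K\<close>, and the third remains as the decay exponent of the union
    bound.\<close>
  define \<delta> where "\<delta> = (hz - hy - R) / 3"
  have \<delta>: "\<delta> > 0" using R by (simp add: \<delta>_def hy_def hz_def)
  have gap: "R - hz + hy + 2 * \<delta> = - \<delta>" by (simp add: \<delta>_def field_simps)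
  \<comment> \<open>Makes the exponent of \<open>K\<close> nonnegative, so that rounding
    \<open>2 powr\<close> of it up to an integer at most doubles it.\<close>
  have hz1: "hz \<le> 1"
  proof -
    have "hz \<le> q1s * 1 + (1 - q1s) * 1"
      unfolding hz_def using q p by (intro add_mono mult_left_mono bin_entropy_le_1) auto
    then show ?thesis by simp
  qed
  obtain Vy where Vy: "Vy \<ge> 0" "\<And>N B. N \<ge> 1 \<Longrightarrow> B \<ge> 1 \<Longrightarrow>
     (\<Sum>s\<in>bits B. pmf (bern_list (replicate B q1)) s *
      measure_pmf.prob (bf_noise p1 p2 N B s) (atypical hy \<delta> (N * B) (bf_noise p1 p2 N B s))) \<le> Vy / real B"
    using block_fading_atypical[OF p(1-4) q(1,2) hy_def \<delta>] by blast
  obtain Vz where Vz: "Vz \<ge> 0" "\<And>N B. N \<ge> 1 \<Longrightarrow> B \<ge> 1 \<Longrightarrow>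
     (\<Sum>s\<in>bits B. pmf (bern_list (replicate B q1s)) s *
      measure_pmf.prob (bf_noise p1s p2s N B s) (atypical hz \<delta> (N * B) (bf_noise p1s p2s N B s))) \<le> Vz / real B"
    using block_fading_atypical[OF p(5-8) q(3,4) hz_def \<delta>] by blast
  show ?thesis
  \<comment> \<open>\<open>Vy\<close> comes from atypical receiver noise,
    \<open>4 / (\<delta> * ln 2)\<close> from the union bound, with a factor 2 each for rounding
    \<open>M\<close> and \<open>K\<close>, and \<open>1 + 2 * Vz\<close> from the leakage
    rate.\<close>
  proof (intro exI[of _ "Vy + 4 / (\<delta> * ln 2) + 1 + 2 * Vz"] allI impI)
    fix N B :: nat assume N: "N \<ge> 1" and B: "B \<ge> 1"
    define n where "n = N * B"
    define M where "M = nat \<lceil>2 powr (real n * R)\<rceil>"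
    define K where "K = nat \<lceil>2 powr (real n * (1 - hz + \<delta>))\<rceil>"
    define \<theta> where "\<theta> = 2 powr (- (real n * (hy + \<delta>)))"
    let ?T = "states B q1 q1s"
    let ?Y = "\<lambda>t. bf_noise p1 p2 N B (fst t)" and ?Z = "\<lambda>t. bf_noise p1s p2s N B (snd t)"
    let ?Ay = "\<lambda>s. measure_pmf.prob (bf_noise p1 p2 N B s) (atypical hy \<delta> n (bf_noise p1 p2 N B s))"
    let ?Az = "\<lambda>s. measure_pmf.prob (bf_noise p1s p2s N B s) (atypical hz \<delta> n (bf_noise p1s p2s N B s))"
    have n1: "n \<ge> 1" using N B by (simp add: n_def)
    then have n0: "real n \<ge> 1" by simp
    have nB: "real B \<le> real n" using N unfolding n_def of_nat_le_iff by simp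
    have B0: "real B > 0" using B by simp
    have M: "1 \<le> M" "real M \<le> 2 * 2 powr (real n * R)"
      unfolding M_def using R n0 nat_ceiling_powr_bounds[of "real n * R"] by auto
    have Kx: "0 \<le> real n * (1 - hz + \<delta>)" using n0 hz1 \<delta> by simp
    have K: "1 \<le> K" "2 powr (real n * (1 - hz + \<delta>)) \<le> real K" "real K \<le> 2 * 2 powr (real n * (1 - hz + \<delta>))"
      unfolding K_def by (rule nat_ceiling_powr_bounds[OF Kx])+
    have noise: "set_pmf (bf_noise pa pb N B s) \<subseteq> bits n" for pa pb s
      using set_bf_noise by (simp add: n_def)
    have one: "(\<Sum>t\<in>set_pmf ?T. pmf ?T t) = 1" using finite_set_states by (intro sum_pmf_eq_1) auto
    obtain f g where f: "\<forall>m<M. set_pmf (f m) \<subseteq> bits n" and fg: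
      "(\<Sum>t\<in>set_pmf ?T. pmf ?T t * ((\<Sum>m<M. measure_pmf.prob (noisy (?Y t) (f m)) {y. g y t \<noteq> m}) / M)) +
       1 / real n * (\<Sum>t\<in>set_pmf ?T. pmf ?T t * mutual_inf (bits n) (pmf_of_set {..<M}) (\<lambda>m. noisy (?Z t) (f m)))
      \<le> (\<Sum>t\<in>set_pmf ?T. pmf ?T t * measure_pmf.prob (?Y t) {e. pmf (?Y t) e < \<theta>}) + real M * real K / (\<theta> * 2 ^ n)
      + 1 / real n * (\<Sum>t\<in>set_pmf ?T. pmf ?T t * (\<Sum>e\<in>bits n. pmf (?Z t) e * log 2 (1 + 2 ^ n * pmf (?Z t) e / K)))"
      \<comment> \<open>The weight \<open>b = 1 / n\<close> puts the leakage on the scale of a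
        rate.\<close>
      using exists_wiretap_code[of ?T ?Y n ?Z M K \<theta> "1 / real n", OF finite_set_states noise noise M(1) K(1)]
      by (auto simp: \<theta>_def)
    have err: "(\<Sum>t\<in>set_pmf ?T. pmf ?T t * measure_pmf.prob (?Y t) {e. pmf (?Y t) e < \<theta>}) \<le> Vy / real B"
    proof -
      have "(\<Sum>t\<in>set_pmf ?T. pmf ?T t * measure_pmf.prob (?Y t) {e. pmf (?Y t) e < \<theta>})
        \<le> (\<Sum>t\<in>set_pmf ?T. pmf ?T t * ?Ay (fst t))"
        unfolding \<theta>_def by (intro sum_mono mult_left_mono prob_small_pmf_le_atypical noise) auto
      also have "\<dots> \<le> Vy / real B"
        unfolding sum_states_fst[of B q1 q1s ?Ay] unfolding n_def by (rule Vy(2)[OF N B])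
      finally show ?thesis .
    qed
    have leak: "(\<Sum>t\<in>set_pmf ?T. pmf ?T t * (\<Sum>e\<in>bits n. pmf (?Z t) e * log 2 (1 + 2 ^ n * pmf (?Z t) e / K)))
        \<le> 1 + (real n + 1) * (Vz / real B)"
    proof -
      have "(\<Sum>t\<in>set_pmf ?T. pmf ?T t * (\<Sum>e\<in>bits n. pmf (?Z t) e * log 2 (1 + 2 ^ n * pmf (?Z t) e / K)))
        \<le> (\<Sum>t\<in>set_pmf ?T. pmf ?T t * (1 + (real n + 1) * ?Az (snd t)))"
        by (intro sum_mono mult_left_mono leak_exponent_le_atypical noise K) auto
      also have "\<dots> = 1 + (real n + 1) * (\<Sum>t\<in>set_pmf ?T. pmf ?T t * ?Az (snd t))"
        by (simp only: distrib_left sum.distrib one mult_1_right sum_distrib_left mult.left_commute)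
      also have "\<dots> \<le> 1 + (real n + 1) * (Vz / real B)"
        unfolding sum_states_snd[of B q1 q1s ?Az] unfolding n_def
        by (intro add_left_mono mult_left_mono Vz(2)[OF N B]) simp
      finally show ?thesis .
    qed
    have union: "real M * real K / (\<theta> * 2 ^ n) \<le> 4 / (\<delta> * ln 2) / real B"
    proof -
      have \<theta>2: "\<theta> * 2 ^ n = 2 powr (real n - real n * (hy + \<delta>))"
        by (simp add: \<theta>_def powr_realpow[symmetric] powr_diff powr_minus_divide)
      have "real M * real K / (\<theta> * 2 ^ n) \<le>
          (2 * 2 powr (real n * R)) * (2 * 2 powr (real n * (1 - hz + \<delta>))) / 2 powr (real n - real n * (hy + \<delta>))"
        unfolding \<theta>2 using M K by (intro divide_right_mono mult_mono) auto
      also have "(2 * 2 powr (real n * R)) * (2 * 2 powr (real n * (1 - hz + \<delta>))) / 2 powr (real n - real n * (hy + \<delta>))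
          = 4 * 2 powr (real n * R + real n * (1 - hz + \<delta>) - (real n - real n * (hy + \<delta>)))"
        by (simp add: powr_add powr_diff)
      also have "real n * R + real n * (1 - hz + \<delta>) - (real n - real n * (hy + \<delta>)) = real n * (R - hz + hy + 2 * \<delta>)"
        by (simp add: algebra_simps)
      also have "\<dots> = - (real n * \<delta>)" by (simp add: gap)
      also have "4 * 2 powr (- (real n * \<delta>)) \<le> 4 * (1 / (real n * \<delta> * ln 2))"
        using n0 \<delta> by (intro mult_left_mono powr_minus_le) auto
      also have "\<dots> = 4 / (\<delta> * ln 2) / real n" by simp
      also have "\<dots> \<le> 4 / (\<delta> * ln 2) / real B"
        using nB B0 \<delta> by (intro divide_left_mono) auto
      finally show ?thesis .
    qed
    have "1 / real n * (1 + (real n + 1) * (Vz / real B)) \<le> (1 + 2 * Vz) / real B"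
    proof -
      have "1 / x * (1 + (x + 1) * v) = 1 / x + (1 + 1 / x) * v" if "x \<ge> 1" for x v :: real
        using that by (simp add: field_simps)
      then have "1 / real n * (1 + (real n + 1) * (Vz / real B)) = 1 / real n + (1 + 1 / real n) * (Vz / real B)"
        using n0 by blast
      also have "\<dots> \<le> 1 / real B + 2 * (Vz / real B)"
        using nB B0 n0 Vz(1) by (intro add_mono mult_right_mono divide_left_mono) auto
      finally show ?thesis by (simp add: add_divide_distrib)
    qed
    moreover have "1 / real n * (\<Sum>t\<in>set_pmf ?T. pmf ?T t * (\<Sum>e\<in>bits n. pmf (?Z t) e * log 2 (1 + 2 ^ n * pmf (?Z t) e / K)))
       \<le> 1 / real n * (1 + (real n + 1) * (Vz / real B))"
      by (intro mult_left_mono leak) simp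
    moreover have "wt_err q1 q1s p1 p2 p1s p2s N B M f g =
      (\<Sum>t\<in>set_pmf ?T. pmf ?T t * ((\<Sum>m<M. measure_pmf.prob (noisy (?Y t) (f m)) {y. g y t \<noteq> m}) / M))"
      by (rule wt_err_eq[OF M(1)])
    moreover have "wt_leak q1 q1s p1 p2 p1s p2s N B M f / real n =
      1 / real n * (\<Sum>t\<in>set_pmf ?T. pmf ?T t * mutual_inf (bits n) (pmf_of_set {..<M}) (\<lambda>m. noisy (?Z t) (f m)))"
      using wt_leak_eq[OF M(1), of f N B] f by (simp add: n_def)
    moreover have "(Vy + 4 / (\<delta> * ln 2) + 1 + 2 * Vz) / real B = Vy / real B + 4 / (\<delta> * ln 2) / real B + (1 + 2 * Vz) / real B"
      by (simp add: add_divide_distrib)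
    ultimately have "wt_err q1 q1s p1 p2 p1s p2s N B M f g + wt_leak q1 q1s p1 p2 p1s p2s N B M f / real n
        \<le> (Vy + 4 / (\<delta> * ln 2) + 1 + 2 * Vz) / real B"
      using fg err union by linarith
    then show "\<exists>f g. (\<forall>m < nat \<lceil>2 powr (real (N * B) * R)\<rceil>. set_pmf (f m) \<subseteq> bits (N * B)) \<and>
     wt_err q1 q1s p1 p2 p1s p2s N B (nat \<lceil>2 powr (real (N * B) * R)\<rceil>) f g
     + wt_leak q1 q1s p1 p2 p1s p2s N B (nat \<lceil>2 powr (real (N * B) * R)\<rceil>) f / real (N * B)
     \<le> (Vy + 4 / (\<delta> * ln 2) + 1 + 2 * Vz) / real B"
      using f unfolding M_def n_def by blast
  qed
qed

lemma achievability:
  assumes q: "0 \<le> q1" "q1 \<le> 1" "0 \<le> q1s" "q1s \<le> 1"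
    and p: "0 \<le> p1" "p1 \<le> 1" "0 \<le> p2" "p2 \<le> 1" "0 \<le> p1s" "p1s \<le> 1" "0 \<le> p2s" "p2s \<le> 1"
    and R: "0 \<le> R" "R < q1s * bin_entropy p1s + (1 - q1s) * bin_entropy p2s
       - q1 * bin_entropy p1 - (1 - q1) * bin_entropy p2"
  shows "achievable_csid q1 q1s p1 p2 p1s p2s R"
proof -
  define n where "n = (\<lambda>j. Suc j * Suc j)"
  define M where "M = (\<lambda>j. nat \<lceil>2 powr (real (n j) * R)\<rceil>)"
  obtain D where D: "\<And>N B. N \<ge> 1 \<Longrightarrow> B \<ge> 1 \<Longrightarrow> \<exists>f g.
     (\<forall>m < nat \<lceil>2 powr (real (N * B) * R)\<rceil>. set_pmf (f m) \<subseteq> bits (N * B)) \<and>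
     wt_err q1 q1s p1 p2 p1s p2s N B (nat \<lceil>2 powr (real (N * B) * R)\<rceil>) f g
     + wt_leak q1 q1s p1 p2 p1s p2s N B (nat \<lceil>2 powr (real (N * B) * R)\<rceil>) f / real (N * B) \<le> D / real B"
    using code_existence[OF assms] by blast
  \<comment> \<open>Both the block length and the number of blocks are \<open>j + 1\<close>.\<close>
  have "\<exists>f g. (\<forall>m < M j. set_pmf (f m) \<subseteq> bits (n j)) \<and>
     wt_err q1 q1s p1 p2 p1s p2s (Suc j) (Suc j) (M j) f g
     + wt_leak q1 q1s p1 p2 p1s p2s (Suc j) (Suc j) (M j) f / real (n j) \<le> D / real (Suc j)" for j
    unfolding M_def n_def by (rule D) auto
  then obtain f g where f: "\<And>j m. m < M j \<Longrightarrow> set_pmf (f j m) \<subseteq> bits (n j)"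
    and fg: "\<And>j. wt_err q1 q1s p1 p2 p1s p2s (Suc j) (Suc j) (M j) (f j) (g j)
     + wt_leak q1 q1s p1 p2 p1s p2s (Suc j) (Suc j) (M j) (f j) / real (n j) \<le> D / real (Suc j)"
    by metis
  have n0: "real (n j) > 0" for j by (simp add: n_def del: of_nat_mult of_nat_Suc)
  have M: "M j \<ge> 1" "2 powr (real (n j) * R) \<le> real (M j)" for j
    using nat_ceiling_powr_bounds[of "real (n j) * R"] R(1) by (auto simp: M_def)
  have leak0: "0 \<le> wt_leak q1 q1s p1 p2 p1s p2s (Suc j) (Suc j) (M j) (f j) / real (n j)" for j
    using f[of _ j] unfolding n_def by (intro divide_nonneg_nonneg wt_leak_nonneg M) auto
  have err0: "0 \<le> wt_err q1 q1s p1 p2 p1s p2s (Suc j) (Suc j) (M j) (f j) (g j)" for j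
    by (simp add: wt_err_def)
  have lim: "(\<lambda>j. D / real (Suc j)) \<longlonglongrightarrow> 0"
    by (rule LIMSEQ_Suc[OF lim_const_over_n])
  have rate: "R \<le> log 2 (real (M j)) / real (n j)" for j
  proof -
    have "real (n j) * R \<le> log 2 (real (M j))"
      using M[of j] by (simp add: le_log_iff)
    then show ?thesis using n0[of j] by (simp add: le_divide_eq mult.commute)
  qed
  show ?thesis unfolding achievable_csid_def
  proof (rule exI[of _ Suc], rule exI[of _ Suc], rule exI[of _ M], rule exI[of _ f], rule exI[of _ g],
      intro conjI allI impI)
    show "1 \<le> M j" for j by (rule M)
    show "length x = Suc j * Suc j" if "m < M j" "x \<in> set_pmf (f j m)" for j m x
      using f[OF that(1)] that(2) by (auto simp: n_def)
    show "filterlim Suc at_top sequentially" by (rule filterlim_Suc)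
    then show "filterlim Suc at_top sequentially" .
    show "eventually (\<lambda>j. R - \<epsilon> \<le> log 2 (real (M j)) / real (Suc j * Suc j)) sequentially" if "\<epsilon> > 0" for \<epsilon>
      using rate that unfolding n_def by (intro always_eventually allI) (smt (verit))
    show "(\<lambda>j. wt_err q1 q1s p1 p2 p1s p2s (Suc j) (Suc j) (M j) (f j) (g j)) \<longlonglongrightarrow> 0"
    proof (rule tendsto_sandwich[OF _ _ tendsto_const lim])
      show "\<forall>\<^sub>F j in sequentially. wt_err q1 q1s p1 p2 p1s p2s (Suc j) (Suc j) (M j) (f j) (g j) \<le> D / real (Suc j)"
        using fg leak0 by (intro always_eventually allI) (smt (verit))
    qed (use err0 in auto)
    show "(\<lambda>j. wt_leak q1 q1s p1 p2 p1s p2s (Suc j) (Suc j) (M j) (f j) / real (Suc j * Suc j)) \<longlonglongrightarrow> 0"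
    proof (rule tendsto_sandwich[OF _ _ tendsto_const lim])
      show "\<forall>\<^sub>F j in sequentially. wt_leak q1 q1s p1 p2 p1s p2s (Suc j) (Suc j) (M j) (f j) / real (Suc j * Suc j) \<le> D / real (Suc j)"
        using fg err0 unfolding n_def by (intro always_eventually allI) (smt (verit))
    qed (use leak0 in \<open>auto simp: n_def\<close>)
  qed
qed

text \<open>The code with a single message. It makes the set of achievable rates nonempty, and it
  settles the case of a formula value at most 0, where \<open>achievability\<close> supplies no
  rate.\<close>

lemma achievable_0: "achievable_csid q1 q1s p1 p2 p1s p2s 0"
proof -
  let ?x = "\<lambda>j. replicate (Suc j * Suc j) True"
  have err: "wt_err q1 q1s p1 p2 p1s p2s N B 1 f (\<lambda>_ _. 0) = 0" for N B f
    by (subst wt_err_eq) auto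
  have leak: "wt_leak q1 q1s p1 p2 p1s p2s (Suc j) (Suc j) 1 (\<lambda>_. return_pmf (?x j)) = 0" for j
  proof -
    have kl0: "kl S p p = 0" for S and p :: "bool list \<Rightarrow> real"
      unfolding kl_def by (intro sum.neutral) auto
    have "pmf_of_set {..<1::nat} = return_pmf 0" by (simp add: lessThan_Suc pmf_of_set_singleton)
    then have "mutual_inf S (pmf_of_set {..<1::nat}) K = 0" for S and K :: "nat \<Rightarrow> bool list pmf"
      by (simp add: mutual_inf_def bind_return_pmf kl0)
    then show ?thesis by (subst wt_leak_eq) auto
  qed
  show ?thesis unfolding achievable_csid_def
    by (rule exI[of _ Suc], rule exI[of _ Suc], rule exI[of _ "\<lambda>_. 1"],
        rule exI[of _ "\<lambda>j _. return_pmf (?x j)"], rule exI[of _ "\<lambda>_ _ _. 0"])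
       (auto simp: err[simplified] leak[simplified] filterlim_Suc)
qed

theorem theorem3:
  fixes q1 q1s p1 p2 p1s p2s :: real
  assumes "0 \<le> q1" "q1 \<le> 1" "0 \<le> q1s" "q1s \<le> 1"
    and "0 \<le> p1" "p1 \<le> p2" "p2 \<le> p1s" "p1s \<le> p2s" "p2s \<le> 1/2"
  shows "secrecy_capacity_csid q1 q1s p1 p2 p1s p2s =
     q1s * bin_entropy p1s + (1 - q1s) * bin_entropy p2s
       - q1 * bin_entropy p1 - (1 - q1) * bin_entropy p2"
    (is "_ = ?C")
  unfolding secrecy_capacity_csid_def
proof (rule cSup_eq_non_empty)
  show "{R. achievable_csid q1 q1s p1 p2 p1s p2s R} \<noteq> {}" using achievable_0 by blast
  show "R \<le> ?C" if "R \<in> {R. achievable_csid q1 q1s p1 p2 p1s p2s R}" for R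
    using converse[OF assms] that by blast
  fix u assume u: "\<And>R. R \<in> {R. achievable_csid q1 q1s p1 p2 p1s p2s R} \<Longrightarrow> R \<le> u"
  have ach: "achievable_csid q1 q1s p1 p2 p1s p2s R" if "0 \<le> R" "R < ?C" for R
    using assms that by (intro achievability) auto
  show "?C \<le> u"
  proof (cases "0 < ?C")
    case True
    then show ?thesis
    proof (rule dense_le_bounded)
      fix R assume "0 < R" "R < ?C"
      then show "R \<le> u" using ach u by simp
    qed
  next
    case False
    \<comment> \<open>This case split avoids proving that the entropy difference is
      nonnegative.\<close>
    have "0 \<le> u" using u achievable_0 by blast
    then show ?thesis using False by linarith
  qed
qed

end
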